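(* Let $X\subseteq Q$ be a computable compact set that does not properly contain a subset homeomorphic to $X$. Let $Y\subseteq Q$ be a simple copy of $X$. If $Y$ is semicomputable then $Y$ is computable.
   Context: $Q=[0,1]^{\mathbb N}$ is the Hilbert cube with metric $d_Q(x,y)=\sum_i2^{-i}|x_i-y_i|$; rational balls have rational radius and rational centers with finitely many nonzero coordinates. A compact $K\subseteq Q$ is semicomputable if the set of finite lists of rational balls whose union contains $K$ is c.e.; computable if moreover the set of rational balls meeting $K$ is c.e. A modulus of uniform continuity of a continuous map $f$ between compact metric spaces is a function $\mu:\mathbb N\to\mathbb N$ such that $d(x,x')<2^{-\mu(n)}$ implies $d(f(x),f(x'))\leq2^{-n}$. A subset $Y\subseteq Q$ is a simple copy of $X$ if there is a homeomorphism $f:X\to Y$ such that both $f$ and $f^{-1}$ have a computable modulus of uniform continuity. *)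

theory Defs
  imports "HOL-Analysis.Analysis" "HOL-Library.Nat_Bijection"
begin

section \<open>Computable functions and computably enumerable sets\<close>

text \<open>
  The total recursive functions as the least class closed under composition, primitive recursion
  and minimization of regular functions. In \<open>mu_recursive n f\<close> the function takes lists of \<open>n\<close>
  arguments; its values on lists of other lengths are irrelevant. Since minimization is only applied
  when a zero exists for all arguments, the class consists of exactly the computable total functions.
\<close>

inductive mu_recursive :: "nat \<Rightarrow> (nat list \<Rightarrow> nat) \<Rightarrow> bool" where
  zero: "mu_recursive n (\<lambda>xs. 0)"
| succ: "mu_recursive 1 (\<lambda>xs. Suc (xs ! 0))"
| proj: "i < n \<Longrightarrow> mu_recursive n (\<lambda>xs. xs ! i)"
| comp: "mu_recursive (length hs) g \<Longrightarrow> (\<forall>h\<in>set hs. mu_recursive n h) \<Longrightarrow>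
    mu_recursive n (\<lambda>xs. g (map (\<lambda>h. h xs) hs))"
| prim_rec: "mu_recursive n g \<Longrightarrow> mu_recursive (Suc (Suc n)) h \<Longrightarrow>
    mu_recursive (Suc n) (\<lambda>xs. rec_nat (g (tl xs)) (\<lambda>k r. h (k # r # tl xs)) (hd xs))"
| minimize: "mu_recursive (Suc n) g \<Longrightarrow> (\<forall>xs. length xs = n \<longrightarrow> (\<exists>k. g (k # xs) = 0)) \<Longrightarrow>
    mu_recursive n (\<lambda>xs. LEAST k. g (k # xs) = 0)"

definition computable_fun :: "(nat \<Rightarrow> nat) \<Rightarrow> bool" where
  "computable_fun f \<longleftrightarrow> (\<exists>g. mu_recursive 1 g \<and> (\<forall>n. f n = g [n]))"

definition ce_set :: "nat set \<Rightarrow> bool" where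
  "ce_set A \<longleftrightarrow> A = {} \<or> (\<exists>f. computable_fun f \<and> A = range f)"


section \<open>The Hilbert cube\<close>

definition hilbert_cube :: "(nat \<Rightarrow> real) set" where
  "hilbert_cube = {x. \<forall>i. x i \<in> {0..1}}"

text \<open>
  The unordered sum \<open>infsum\<close> agrees with \<open>suminf\<close> on the cube; unlike \<open>suminf\<close> it is \<open>0\<close> for
  divergent series, and the locale \<open>Metric_space\<close> requires a nonnegative distance
  even for points outside the carrier.
\<close>

definition dist_Q :: "(nat \<Rightarrow> real) \<Rightarrow> (nat \<Rightarrow> real) \<Rightarrow> real" where
  "dist_Q x y = (\<Sum>\<^sub>\<infinity>i. (1/2) ^ i * \<bar>x i - y i\<bar>)"

lemma dist_Q_summable:
  assumes "x \<in> hilbert_cube" "y \<in> hilbert_cube"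
  shows "(\<lambda>i. (1/2) ^ i * \<bar>x i - y i\<bar>) summable_on UNIV"
proof -
  have bnd: "\<bar>x i - y i\<bar> \<le> 1" for i
  proof -
    have "0 \<le> x i" "x i \<le> 1" "0 \<le> y i" "y i \<le> 1"
      using assms by (auto simp: hilbert_cube_def)
    then show ?thesis by linarith
  qed
  have "summable (\<lambda>i. norm ((1/2) ^ i * \<bar>x i - y i\<bar>))"
  proof (rule summable_comparison_test')
    show "summable (\<lambda>i. (1/2::real) ^ i)" by (simp add: summable_geometric_iff)
    show "norm (norm ((1/2) ^ i * \<bar>x i - y i\<bar>)) \<le> (1/2) ^ i" if "0 \<le> i" for i
      using bnd[of i] by (simp add: abs_mult mult_left_le)
  qed
  then show ?thesis by (rule norm_summable_imp_summable_on)
qed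

lemma dist_Q_eq_suminf:
  assumes "x \<in> hilbert_cube" "y \<in> hilbert_cube"
  shows "dist_Q x y = (\<Sum>i. (1/2) ^ i * \<bar>x i - y i\<bar>)"
proof -
  have "((\<lambda>i. (1/2) ^ i * \<bar>x i - y i\<bar>) has_sum dist_Q x y) UNIV"
    unfolding dist_Q_def using dist_Q_summable[OF assms] by (rule has_sum_infsum)
  then show ?thesis by (simp add: has_sum_imp_sums sums_unique)
qed

interpretation Q: Metric_space hilbert_cube dist_Q
proof
  fix x y
  show "0 \<le> dist_Q x y" unfolding dist_Q_def by (rule infsum_nonneg) simp
  show "dist_Q x y = dist_Q y x" by (simp add: dist_Q_def abs_minus_commute)
next
  fix x y assume xy: "x \<in> hilbert_cube" "y \<in> hilbert_cube"
  show "dist_Q x y = 0 \<longleftrightarrow> x = y"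
  proof
    assume z: "dist_Q x y = 0"
    have "(1/2) ^ i * \<bar>x i - y i\<bar> = 0" for i
      by (rule nonneg_infsum_le_0D[OF _ dist_Q_summable[OF xy]])
        (use z in \<open>auto simp: dist_Q_def\<close>)
    then show "x = y" by auto
  qed (simp add: dist_Q_def)
next
  fix x y z
  assume "x \<in> hilbert_cube" "y \<in> hilbert_cube" "z \<in> hilbert_cube"
  note s = dist_Q_summable[OF this(1,3)] dist_Q_summable[OF this(1,2)] dist_Q_summable[OF this(2,3)]
  have "dist_Q x z \<le> (\<Sum>\<^sub>\<infinity>i. (1/2) ^ i * \<bar>x i - y i\<bar> + (1/2) ^ i * \<bar>y i - z i\<bar>)"
    unfolding dist_Q_def
  proof (rule infsum_mono[OF s(1) summable_on_add[OF s(2,3)]])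
    fix i
    have "\<bar>x i - z i\<bar> \<le> \<bar>x i - y i\<bar> + \<bar>y i - z i\<bar>" by linarith
    then show "(1/2) ^ i * \<bar>x i - z i\<bar> \<le> (1/2) ^ i * \<bar>x i - y i\<bar> + (1/2) ^ i * \<bar>y i - z i\<bar>"
      by (metis distrib_left mult_left_mono zero_le_divide_1_iff zero_le_numeral zero_le_power)
  qed
  also have "\<dots> = dist_Q x y + dist_Q y z"
    unfolding dist_Q_def by (rule infsum_add[OF s(2,3)])
  finally show "dist_Q x z \<le> dist_Q x y + dist_Q y z" .
qed

abbreviation subspace_Q :: "(nat \<Rightarrow> real) set \<Rightarrow> (nat \<Rightarrow> real) topology" where
  "subspace_Q A \<equiv> subtopology Q.mtopology A"


section \<open>Rational balls and computability of compact sets\<close>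

text \<open>
  A rational ball is presented by a list of the leading coordinates of its center
  (the remaining ones being zero) and its radius.
\<close>

type_synonym rational_ball = "rat list \<times> rat"

definition rational_balls :: "rational_ball set" where
  "rational_balls = {(cs, r). set cs \<subseteq> {0..1} \<and> 0 < r}"

definition ball_center :: "rational_ball \<Rightarrow> nat \<Rightarrow> real" where
  "ball_center b = (\<lambda>i. if i < length (fst b) then of_rat (fst b ! i) else 0)"

definition ball_set :: "rational_ball \<Rightarrow> (nat \<Rightarrow> real) set" where
  "ball_set b = Q.mball (ball_center b) (of_rat (snd b))"

text \<open>Injective codes, using reduced fractions with positive denominator.\<close>

definition rat_encode :: "rat \<Rightarrow> nat" where
  "rat_encode q = prod_encode (int_encode (fst (quotient_of q)), nat (snd (quotient_of q)))"

definition ball_encode :: "rational_ball \<Rightarrow> nat" where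
  "ball_encode b = prod_encode (list_encode (map rat_encode (fst b)), rat_encode (snd b))"

definition ball_list_encode :: "rational_ball list \<Rightarrow> nat" where
  "ball_list_encode bs = list_encode (map ball_encode bs)"

definition semicomputable :: "(nat \<Rightarrow> real) set \<Rightarrow> bool" where
  "semicomputable K \<longleftrightarrow> compactin Q.mtopology K \<and>
     ce_set (ball_list_encode ` {bs \<in> lists rational_balls. K \<subseteq> (\<Union>b\<in>set bs. ball_set b)})"

definition computable_compact :: "(nat \<Rightarrow> real) set \<Rightarrow> bool" where
  "computable_compact K \<longleftrightarrow> semicomputable K \<and>
     ce_set (ball_encode ` {b \<in> rational_balls. ball_set b \<inter> K \<noteq> {}})"


section \<open>Simple copies\<close>

definition uniform_modulus ::
  "(nat \<Rightarrow> nat) \<Rightarrow> (nat \<Rightarrow> real) set \<Rightarrow> ((nat \<Rightarrow> real) \<Rightarrow> (nat \<Rightarrow> real)) \<Rightarrow> bool" where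
  "uniform_modulus \<mu> A f \<longleftrightarrow>
     (\<forall>n. \<forall>x\<in>A. \<forall>x'\<in>A. dist_Q x x' < (1/2) ^ \<mu> n \<longrightarrow> dist_Q (f x) (f x') \<le> (1/2) ^ n)"

definition has_computable_modulus ::
  "(nat \<Rightarrow> real) set \<Rightarrow> ((nat \<Rightarrow> real) \<Rightarrow> (nat \<Rightarrow> real)) \<Rightarrow> bool" where
  "has_computable_modulus A f \<longleftrightarrow> (\<exists>\<mu>. computable_fun \<mu> \<and> uniform_modulus \<mu> A f)"

definition simple_copy :: "(nat \<Rightarrow> real) set \<Rightarrow> (nat \<Rightarrow> real) set \<Rightarrow> bool" where
  "simple_copy Y X \<longleftrightarrow> Y \<subseteq> hilbert_cube \<and>
     (\<exists>f g. homeomorphic_maps (subspace_Q X) (subspace_Q Y) f g \<and>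
        has_computable_modulus X f \<and> has_computable_modulus Y g)"

end

theory Submission
  imports Defs "HOL-Library.Diagonal_Subsequence"
begin

text \<open>
  A rational ball \<open>B\<close> meets \<open>Y\<close> iff no map on \<open>X\<close> that obeys the moduli of \<open>f\<close> and of its inverse \<open>g\<close>
  takes all its values in \<open>Y - B\<close>: if \<open>B\<close> misses \<open>Y\<close> then \<open>f\<close> is such a map, and conversely such a map
  followed by \<open>g\<close> would embed \<open>X\<close> as a proper subset of itself. By compactness the absence of such a map is
  witnessed by finitely much data: rational balls meeting \<open>X\<close> (enumerable since \<open>X\<close> is computable) and a
  cover of \<open>Y\<close> by small rational balls (enumerable since \<open>Y\<close> is semicomputable), such that every assignment
  of balls of the cover to the balls meeting \<open>X\<close> either puts a ball inside \<open>B\<close> or violates one of the two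
  moduli by more than the radii allow. The last condition is decidable, so the balls meeting \<open>Y\<close> can be
  enumerated by searching for such certificates.
\<close>

section \<open>Recursive functions\<close>

text \<open>The obstacle is that \<open>f\<close> need not be computable: only the two moduli are,
  so a ball around \<open>f x\<close> cannot be computed from a ball around \<open>x\<close>, and
  all maps with these moduli have to be treated at once. A modulus has a strict bound as premise and
  a weak bound as conclusion, and both directions rest on this. A violation is certified by strict
  inequalities between rationals, so it excludes every choice of points in the balls concerned. An
  assignment that escapes satisfies the complementary weak bound wherever the premise holds
  robustly, and weak bounds survive limits. If no certificate exists, one escaping assignment is
  chosen for each precision, and a diagonal subsequence converges at every point of a dense sequence
  of \<open>X\<close>. The inverse modulus is searched along with the direct one because it is what
  makes the limit injective with a continuous inverse; the limit then extends from the dense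
  sequence to all of \<open>X\<close>, and its values stay outside the open ball.\<close>

definition recfn :: "nat \<Rightarrow> (nat list \<Rightarrow> nat) \<Rightarrow> bool" where
  "recfn n f \<longleftrightarrow> (\<exists>g. mu_recursive n g \<and> (\<forall>xs. length xs = n \<longrightarrow> g xs = f xs))"

text \<open>\<open>mu_recursive\<close> speaks of functions on lists of all lengths, so agreement on
  the relevant lists does not preserve it. \<open>recfn\<close> closes the class under such
  agreement, which makes rewriting of bodies legitimate.\<close>

lemma recfn_cong:
  assumes "recfn n f" "\<And>xs. length xs = n \<Longrightarrow> f xs = f' xs"
  shows "recfn n f'"
  using assms unfolding recfn_def by metis

lemma recfn_nth: "i < n \<Longrightarrow> recfn n (\<lambda>xs. xs ! i)"
  unfolding recfn_def using mu_recursive.proj by blast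

lemma recfn_comp:
  assumes g: "recfn (length hs) g" and hs: "\<forall>h\<in>set hs. recfn n h"
  shows "recfn n (\<lambda>xs. g (map (\<lambda>h. h xs) hs))"
proof -
  obtain g' where g': "mu_recursive (length hs) g'" "\<And>xs. length xs = length hs \<Longrightarrow> g' xs = g xs"
    using g unfolding recfn_def by blast
  obtain H where H: "\<And>h. h \<in> set hs \<Longrightarrow> mu_recursive n (H h)"
    "\<And>h xs. h \<in> set hs \<Longrightarrow> length xs = n \<Longrightarrow> H h xs = h xs"
    using hs unfolding recfn_def by metis
  have "mu_recursive n (\<lambda>xs. g' (map (\<lambda>h. h xs) (map H hs)))"
    by (rule mu_recursive.comp) (use g' H in auto)
  moreover have "g' (map (\<lambda>h. h xs) (map H hs)) = g (map (\<lambda>h. h xs) hs)" if "length xs = n" for xs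
  proof -
    have "map (\<lambda>h. h xs) (map H hs) = map (\<lambda>h. h xs) hs"
      using H(2)[OF _ that] by (simp add: comp_def)
    then show ?thesis by (simp only: g'(2) length_map)
  qed
  ultimately show ?thesis unfolding recfn_def by blast
qed

lemma recfn_comp1:
  assumes "recfn 1 (\<lambda>xs. F (xs ! 0))" "recfn n f"
  shows "recfn n (\<lambda>xs. F (f xs))"
  using recfn_comp[of "[f]" "\<lambda>xs. F (xs ! 0)" n] assms by simp

lemma recfn_Suc: "recfn n f \<Longrightarrow> recfn n (\<lambda>xs. Suc (f xs))"
  by (rule recfn_comp1) (use mu_recursive.succ in \<open>auto simp: recfn_def\<close>)

lemma recfn_const: "recfn n (\<lambda>xs. c)"
proof (induction c)
  case 0
  show ?case unfolding recfn_def using mu_recursive.zero by blast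
next
  case (Suc c)
  then show ?case by (rule recfn_Suc)
qed

lemma map_nth_projections:
  "length xs = n \<Longrightarrow> map (\<lambda>h. h xs) (map (\<lambda>i xs. xs ! i) [0..<n]) = xs"
  by (auto intro: nth_equalityI)

text \<open>The primitive scheme recurses on the head of the argument list. Composing it with
  \<open>a\<close> followed by all projections frees the recursion depth while the whole list
  remains available as parameter.\<close>

lemma recfn_rec_nat:
  assumes a: "recfn n a" and g: "recfn n g" and h: "recfn (Suc (Suc n)) h"
  shows "recfn n (\<lambda>xs. rec_nat (g xs) (\<lambda>k r. h (k # r # xs)) (a xs))"
proof -
  obtain g' where g': "mu_recursive n g'" "\<And>xs. length xs = n \<Longrightarrow> g' xs = g xs"
    using g unfolding recfn_def by blast
  obtain h' where h': "mu_recursive (Suc (Suc n)) h'" "\<And>xs. length xs = Suc (Suc n) \<Longrightarrow> h' xs = h xs"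
    using h unfolding recfn_def by blast
  let ?R = "\<lambda>xs. rec_nat (g' (tl xs)) (\<lambda>k r. h' (k # r # tl xs)) (hd xs)"
  let ?hs = "a # map (\<lambda>i xs. xs ! i) [0..<n]"
  have "recfn (Suc n) ?R"
    unfolding recfn_def using mu_recursive.prim_rec[OF g'(1) h'(1)] by blast
  then have "recfn (length ?hs) ?R"
    by simp
  moreover have "\<forall>h\<in>set ?hs. recfn n h"
    using a recfn_nth by auto
  ultimately have "recfn n (\<lambda>xs. ?R (map (\<lambda>h. h xs) ?hs))"
    by (rule recfn_comp)
  then show ?thesis
  proof (rule recfn_cong)
    fix xs :: "nat list" assume n: "length xs = n"
    have "map (\<lambda>h. h xs) ?hs = a xs # xs"
      unfolding list.map(2) map_nth_projections[OF n] ..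
    then show "?R (map (\<lambda>h. h xs) ?hs) = rec_nat (g xs) (\<lambda>k r. h (k # r # xs)) (a xs)"
      using g'(2)[OF n] h'(2) n by simp
  qed
qed

lemma recfn_Least:
  assumes g: "recfn (Suc n) g" and ex: "\<And>xs. length xs = n \<Longrightarrow> \<exists>k. g (k # xs) = 0"
  shows "recfn n (\<lambda>xs. LEAST k. g (k # xs) = 0)"
proof -
  obtain g' where g': "mu_recursive (Suc n) g'" "\<And>xs. length xs = Suc n \<Longrightarrow> g' xs = g xs"
    using g unfolding recfn_def by blast
  have "mu_recursive n (\<lambda>xs. LEAST k. g' (k # xs) = 0)"
    by (rule mu_recursive.minimize) (use g' ex in auto)
  then show ?thesis
    unfolding recfn_def using g'(2) by (intro exI[of _ "\<lambda>xs. LEAST k. g' (k # xs) = 0"]) simp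
qed

section \<open>Arithmetic and pairing of naturals\<close>

lemma recfn_add:
  assumes "recfn n f" "recfn n g"
  shows "recfn n (\<lambda>xs. f xs + g xs)"
proof (rule recfn_cong)
  show "recfn n (\<lambda>xs. rec_nat (f xs) (\<lambda>k r. Suc ((k # r # xs) ! 1)) (g xs))"
    by (intro recfn_rec_nat assms recfn_Suc recfn_nth) simp
  have "rec_nat a (\<lambda>k r. Suc r) b = a + b" for a b :: nat
    by (induction b) simp_all
  then show "rec_nat (f xs) (\<lambda>k r. Suc ((k # r # xs) ! 1)) (g xs) = f xs + g xs" for xs
    by simp
qed

lemma recfn_diff:
  assumes "recfn n f" "recfn n g"
  shows "recfn n (\<lambda>xs. f xs - g xs)"
proof (rule recfn_cong)
  have pred: "recfn m (\<lambda>xs. h xs - 1)" if h: "recfn m h" for m h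
  proof (rule recfn_cong)
    \<comment> \<open>The predecessor is the recursion that returns its counter and ignores the
      previous value.\<close>
    show "recfn m (\<lambda>xs. rec_nat 0 (\<lambda>k r. (k # r # xs) ! 0) (h xs))"
      by (intro recfn_rec_nat h recfn_const recfn_nth) simp
    show "rec_nat 0 (\<lambda>k r. (k # r # xs) ! 0) (h xs) = h xs - 1" for xs
      by (cases "h xs") simp_all
  qed
  show "recfn n (\<lambda>xs. rec_nat (f xs) (\<lambda>k r. (k # r # xs) ! 1 - 1) (g xs))"
    by (intro recfn_rec_nat assms pred recfn_nth) simp
  have "rec_nat a (\<lambda>k r. r - 1) b = a - b" for a b :: nat
    by (induction b) simp_all
  then show "rec_nat (f xs) (\<lambda>k r. (k # r # xs) ! 1 - 1) (g xs) = f xs - g xs" for xs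
    by simp
qed

lemma recfn_triangle:
  assumes "recfn n f"
  shows "recfn n (\<lambda>xs. triangle (f xs))"
proof (rule recfn_cong)
  show "recfn n (\<lambda>xs. rec_nat 0 (\<lambda>k r. (k # r # xs) ! 1 + Suc ((k # r # xs) ! 0)) (f xs))"
    by (intro recfn_rec_nat recfn_const recfn_add recfn_Suc recfn_nth assms) simp_all
  have "rec_nat 0 (\<lambda>k r. r + Suc k) a = triangle a" for a
    by (induction a) simp_all
  then show "rec_nat 0 (\<lambda>k r. (k # r # xs) ! 1 + Suc ((k # r # xs) ! 0)) (f xs) = triangle (f xs)" for xs
    by simp
qed

lemma recfn_prod_encode:
  assumes "recfn n f" "recfn n g"
  shows "recfn n (\<lambda>xs. prod_encode (f xs, g xs))"
  unfolding prod_encode_def split by (intro recfn_add recfn_triangle assms)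

abbreviation pfst :: "nat \<Rightarrow> nat" where "pfst z \<equiv> fst (prod_decode z)"
abbreviation psnd :: "nat \<Rightarrow> nat" where "psnd z \<equiv> snd (prod_decode z)"

lemma triangle_mono: "a \<le> b \<Longrightarrow> triangle a \<le> triangle b"
  by (induction b rule: dec_induct) simp_all

text \<open>\<open>prod_encode (a, b)\<close> is \<open>triangle (a + b) + a\<close>, so
  \<open>a + b\<close> is the index of the diagonal containing \<open>z\<close>: the first
  \<open>s\<close> whose successor triangle exceeds \<open>z\<close>. Truncated subtraction turns
  \<open>z < triangle (Suc s)\<close> into an equation with 0, as minimization requires.\<close>

lemma pfst_plus_psnd_eq: "(LEAST s. Suc z - triangle (Suc s) = 0) = pfst z + psnd z"
proof (rule Least_equality)
  have z: "z = triangle (pfst z + psnd z) + pfst z"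
    using prod_decode_inverse[of z] by (simp add: prod_encode_def split_beta del: prod_decode_inverse)
  have "Suc z \<le> triangle (Suc (pfst z + psnd z))"
    using z by simp
  then show "Suc z - triangle (Suc (pfst z + psnd z)) = 0"
    by simp
  fix s assume s: "Suc z - triangle (Suc s) = 0"
  show "pfst z + psnd z \<le> s"
  proof (rule ccontr)
    assume "\<not> pfst z + psnd z \<le> s"
    then have "triangle (Suc s) \<le> triangle (pfst z + psnd z)"
      by (intro triangle_mono) simp
    with s z show False by linarith
  qed
qed

lemma recfn_pfst_plus_psnd:
  assumes "recfn n f"
  shows "recfn n (\<lambda>xs. pfst (f xs) + psnd (f xs))"
proof -
  have "recfn 1 (\<lambda>xs. LEAST s. Suc ((s # xs) ! 1) - triangle (Suc ((s # xs) ! 0)) = 0)"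
  proof (rule recfn_Least)
    show "recfn (Suc 1) (\<lambda>xs. Suc (xs ! 1) - triangle (Suc (xs ! 0)))"
      by (intro recfn_diff recfn_triangle recfn_Suc recfn_nth) simp_all
    \<comment> \<open>The index \<open>s = z\<close> already ends the search, which makes the
      minimization regular.\<close>
    have "a \<le> triangle a" for a
      by (induction a) simp_all
    then show "\<exists>k. Suc ((k # xs) ! 1) - triangle (Suc ((k # xs) ! 0)) = 0" for xs
      by (intro exI[of _ "xs ! 0"]) (simp add: add_increasing)
  qed
  then have "recfn 1 (\<lambda>xs. pfst (xs ! 0) + psnd (xs ! 0))"
    by (simp only: nth_Cons_0 nth_Cons_Suc One_nat_def pfst_plus_psnd_eq)
  then show ?thesis
    using assms by (rule recfn_comp1)
qed

lemma recfn_pfst: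
  assumes "recfn n f"
  shows "recfn n (\<lambda>xs. pfst (f xs))"
proof (rule recfn_cong)
  show "recfn n (\<lambda>xs. f xs - triangle (pfst (f xs) + psnd (f xs)))"
    by (intro recfn_diff recfn_triangle recfn_pfst_plus_psnd assms)
  have "z - triangle (pfst z + psnd z) = pfst z" for z
    using prod_decode_inverse[of z] unfolding prod_encode_def split_beta
    by (metis diff_add_inverse)
  then show "f xs - triangle (pfst (f xs) + psnd (f xs)) = pfst (f xs)" for xs .
qed

lemma recfn_psnd:
  assumes "recfn n f"
  shows "recfn n (\<lambda>xs. psnd (f xs))"
proof (rule recfn_cong)
  show "recfn n (\<lambda>xs. (pfst (f xs) + psnd (f xs)) - pfst (f xs))"
    by (intro recfn_diff recfn_pfst_plus_psnd recfn_pfst assms)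
qed simp

section \<open>Unary recursive functions with paired arguments\<close>

lemma computable_fun_iff: "computable_fun f \<longleftrightarrow> recfn 1 (\<lambda>xs. f (xs ! 0))"
proof
  assume "computable_fun f"
  then obtain g where g: "mu_recursive 1 g" "\<And>n. f n = g [n]"
    unfolding computable_fun_def by blast
  have "g xs = f (xs ! 0)" if "length xs = 1" for xs
    using that g(2) by (auto simp: length_Suc_conv)
  with g(1) show "recfn 1 (\<lambda>xs. f (xs ! 0))"
    unfolding recfn_def by blast
qed (auto simp: recfn_def computable_fun_def)

lemma recfn_computable:
  assumes "computable_fun F" "recfn n f"
  shows "recfn n (\<lambda>xs. F (f xs))"
  using assms unfolding computable_fun_iff by (rule recfn_comp1)

lemma computable_fun_id: "computable_fun (\<lambda>x. x)"
  unfolding computable_fun_iff by (rule recfn_nth) simp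

lemma computable_fun_const: "computable_fun (\<lambda>x. c)"
  unfolding computable_fun_iff by (rule recfn_const)

lemma computable_fun_comp:
  "computable_fun F \<Longrightarrow> computable_fun f \<Longrightarrow> computable_fun (\<lambda>x. F (f x))"
  using recfn_computable[of F 1] unfolding computable_fun_iff by blast

lemma computable_fun_prod_encode:
  "computable_fun f \<Longrightarrow> computable_fun g \<Longrightarrow> computable_fun (\<lambda>x. prod_encode (f x, g x))"
  unfolding computable_fun_iff by (rule recfn_prod_encode)

text \<open>Only unary functions are used from here on, so parameter, counter and previous value
  travel as one nested pair.\<close>

lemma computable_fun_rec_nat:
  assumes f: "computable_fun f" and g: "computable_fun g" and h: "computable_fun h"
  shows "computable_fun (\<lambda>x. rec_nat (g x) (\<lambda>k r. h (prod_encode (x, prod_encode (k, r)))) (f x))"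
proof -
  have "recfn 1 (\<lambda>xs. rec_nat (g (xs ! 0)) (\<lambda>k r.
      h (prod_encode ((k # r # xs) ! 2, prod_encode ((k # r # xs) ! 0, (k # r # xs) ! 1)))) (f (xs ! 0)))"
    by (intro recfn_rec_nat recfn_computable[OF h] recfn_prod_encode recfn_nth
        recfn_computable[OF f] recfn_computable[OF g]) simp_all
  then show ?thesis
    unfolding computable_fun_iff by simp
qed

lemma computable_fun_Least:
  assumes h: "computable_fun h" and ex: "\<And>x. \<exists>k. h (prod_encode (x, k)) = 0"
  shows "computable_fun (\<lambda>x. LEAST k. h (prod_encode (x, k)) = 0)"
proof -
  have "recfn 1 (\<lambda>xs. LEAST k. h (prod_encode ((k # xs) ! 1, (k # xs) ! 0)) = 0)"
    by (intro recfn_Least recfn_computable[OF h] recfn_prod_encode recfn_nth) (use ex in simp_all)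
  then show ?thesis
    unfolding computable_fun_iff by simp
qed

section \<open>Computability on encoded types\<close>

text \<open>Surjectivity is not demanded because the codes of rationals, being reduced fractions, do
  not exhaust the naturals. The instances reproduce \<open>ball_encode\<close> and
  \<open>ball_list_encode\<close>, so results about \<open>encode\<close> apply to the sets in
  \<open>semicomputable\<close> and \<open>computable_compact\<close>.\<close>

class encodable =
  fixes encode :: "'a \<Rightarrow> nat"
  assumes inj_encode: "inj encode"

instantiation nat :: encodable
begin
definition encode_nat :: "nat \<Rightarrow> nat" where [simp]: "encode_nat n = n"
instance by standard (simp add: inj_def)
end

instantiation bool :: encodable
begin
definition encode_bool :: "bool \<Rightarrow> nat" where "encode_bool b = of_bool b"
instance by standard (simp add: inj_def encode_bool_def)
end

instantiation int :: encodable
begin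
definition encode_int :: "int \<Rightarrow> nat" where "encode_int = int_encode"
instance by standard (simp add: encode_int_def inj_int_encode)
end

instantiation rat :: encodable
begin
definition encode_rat :: "rat \<Rightarrow> nat" where "encode_rat = rat_encode"
instance
proof
  have "p = q" if "rat_encode p = rat_encode q" for p q
  proof -
    have "quotient_of p = quotient_of q"
      using that quotient_of_denom_pos'[of p] quotient_of_denom_pos'[of q]
      by (simp add: rat_encode_def int_encode_eq prod_eq_iff nat_eq_iff)
    then show ?thesis
      by (rule quotient_of_inject)
  qed
  then show "inj (encode :: rat \<Rightarrow> nat)"
    by (simp add: inj_def encode_rat_def)
qed
end

instantiation prod :: (encodable, encodable) encodable
begin
definition encode_prod :: "'a \<times> 'b \<Rightarrow> nat"
  where "encode_prod p = prod_encode (encode (fst p), encode (snd p))"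
instance
  by standard (auto simp: inj_def encode_prod_def prod_eq_iff dest: injD[OF inj_encode])
end

instantiation list :: (encodable) encodable
begin
definition encode_list :: "'a list \<Rightarrow> nat" where "encode_list xs = list_encode (map encode xs)"
instance
  by standard (auto simp: inj_def encode_list_def list_encode_eq dest: map_injective[OF _ inj_encode])
end

lemma encode_Pair [simp]: "encode (a, b) = prod_encode (encode a, encode b)"
  by (simp add: encode_prod_def)

lemma encode_Nil [simp]: "encode [] = 0"
  by (simp add: encode_list_def)

lemma encode_Cons [simp]: "encode (x # xs) = Suc (prod_encode (encode x, encode xs))"
  by (simp add: encode_list_def)

text \<open>\<open>F\<close> may do anything at numbers that encode nothing, such as unreduced
  fractions, so no test for valid codes has to be programmed.\<close>

definition computable :: "('a::encodable \<Rightarrow> 'b::encodable) \<Rightarrow> bool" where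
  "computable f \<longleftrightarrow> (\<exists>F. computable_fun F \<and> (\<forall>x. F (encode x) = encode (f x)))"

lemma computableI:
  "computable_fun F \<Longrightarrow> (\<And>x. F (encode x) = encode (f x)) \<Longrightarrow> computable f"
  unfolding computable_def by blast

lemma computableE:
  assumes "computable f"
  obtains F where "computable_fun F" "\<And>x. F (encode x) = encode (f x)"
  using assms unfolding computable_def by blast

lemma computable_nat_iff: "computable f \<longleftrightarrow> computable_fun f" for f :: "nat \<Rightarrow> nat"
proof
  assume "computable f"
  then obtain F where "computable_fun F" "\<And>x. F (encode x) = encode (f x)"
    by (rule computableE) blast
  then have "computable_fun F" "F = f"
    by auto
  then show "computable_fun f"
    by simp
qed (auto intro: computableI)

named_theorems computable_intros

lemma computable_id [computable_intros]: "computable (\<lambda>x. x)"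
  by (rule computableI[OF computable_fun_id]) simp

lemma computable_const [computable_intros]: "computable (\<lambda>x. c)"
  by (rule computableI[OF computable_fun_const]) simp

lemma computable_comp:
  assumes "computable f" "computable g"
  shows "computable (\<lambda>x. f (g x))"
proof -
  obtain F where F: "computable_fun F" "\<And>x. F (encode x) = encode (f x)"
    using assms(1) by (rule computableE) blast
  obtain G where G: "computable_fun G" "\<And>x. G (encode x) = encode (g x)"
    using assms(2) by (rule computableE) blast
  show ?thesis
    by (rule computableI[OF computable_fun_comp[OF F(1) G(1)]]) (simp add: F G)
qed

lemma computable_Pair [computable_intros]:
  assumes "computable f" "computable g"
  shows "computable (\<lambda>x. (f x, g x))"
proof -
  obtain F where F: "computable_fun F" "\<And>x. F (encode x) = encode (f x)"
    using assms(1) by (rule computableE) blast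
  obtain G where G: "computable_fun G" "\<And>x. G (encode x) = encode (g x)"
    using assms(2) by (rule computableE) blast
  show ?thesis
    by (rule computableI[OF computable_fun_prod_encode[OF F(1) G(1)]]) (simp add: F G)
qed

lemma computable_comp2:
  assumes "computable (\<lambda>p. h (fst p) (snd p))" "computable f" "computable g"
  shows "computable (\<lambda>x. h (f x) (g x))"
  using computable_comp[OF assms(1) computable_Pair[OF assms(2,3)]] by simp

lemma computable_fun_pfst: "computable_fun pfst"
  unfolding computable_fun_iff by (intro recfn_pfst recfn_nth) simp

lemma computable_fun_psnd: "computable_fun psnd"
  unfolding computable_fun_iff by (intro recfn_psnd recfn_nth) simp

lemma computable_fst [computable_intros]: "computable f \<Longrightarrow> computable (\<lambda>x. fst (f x))"
  by (rule computable_comp[where f = fst])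
    (auto intro!: computableI[OF computable_fun_pfst] simp: encode_prod_def)

lemma computable_snd [computable_intros]: "computable f \<Longrightarrow> computable (\<lambda>x. snd (f x))"
  by (rule computable_comp[where f = snd])
    (auto intro!: computableI[OF computable_fun_psnd] simp: encode_prod_def)

lemma computable_pfst [computable_intros]: "computable f \<Longrightarrow> computable (\<lambda>x. pfst (f x))"
  by (rule computable_comp[where f = pfst]) (simp add: computable_nat_iff computable_fun_pfst)

lemma computable_psnd [computable_intros]: "computable f \<Longrightarrow> computable (\<lambda>x. psnd (f x))"
  by (rule computable_comp[where f = psnd]) (simp add: computable_nat_iff computable_fun_psnd)

lemma computable_rec_nat [computable_intros]:
  assumes "computable n" "computable a"
    and "computable (\<lambda>p. h (fst p) (fst (snd p)) (snd (snd p)))"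
  shows "computable (\<lambda>x. rec_nat (a x) (h x) (n x))"
proof -
  obtain N where N: "computable_fun N" "\<And>x. N (encode x) = encode (n x)"
    using assms(1) by (rule computableE) blast
  obtain A where A: "computable_fun A" "\<And>x. A (encode x) = encode (a x)"
    using assms(2) by (rule computableE) blast
  obtain H where H: "computable_fun H"
      "\<And>p. H (encode p) = encode (h (fst p) (fst (snd p)) (snd (snd p)))"
    using assms(3) by (rule computableE) blast
  have "rec_nat (A (encode x)) (\<lambda>k r. H (prod_encode (encode x, prod_encode (k, r)))) m
      = encode (rec_nat (a x) (h x) m)" for x m
    using H(2)[of "(x, k, r)" for k r] by (induction m) (simp_all add: A)
  then show ?thesis
    by (intro computableI[OF computable_fun_rec_nat[OF N(1) A(1) H(1)]]) (simp add: N)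
qed

section \<open>Arithmetic, branching and decidable predicates on naturals\<close>

lemma computable_Suc [computable_intros]: "computable f \<Longrightarrow> computable (\<lambda>x. Suc (f x))"
  by (rule computable_comp[where f = Suc])
    (auto simp: computable_nat_iff computable_fun_iff intro: recfn_Suc recfn_nth)

lemma computable_binary_natI:
  assumes "recfn 1 (\<lambda>xs. h (pfst (xs ! 0)) (psnd (xs ! 0)))" "computable f" "computable g"
  shows "computable (\<lambda>x. h (f x) (g x) :: nat)"
proof (rule computable_comp2[OF _ assms(2,3)])
  have "computable_fun (\<lambda>z. h (pfst z) (psnd z))"
    using assms(1) by (simp add: computable_fun_iff)
  then show "computable (\<lambda>p. h (fst p) (snd p))"
    by (rule computableI) (simp add: encode_prod_def)
qed

lemma computable_nat_add [computable_intros]: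
  "computable f \<Longrightarrow> computable g \<Longrightarrow> computable (\<lambda>x. f x + g x :: nat)"
  by (rule computable_binary_natI) (auto intro!: recfn_add recfn_pfst recfn_psnd recfn_nth)

lemma computable_nat_diff [computable_intros]:
  "computable f \<Longrightarrow> computable g \<Longrightarrow> computable (\<lambda>x. f x - g x :: nat)"
  by (rule computable_binary_natI) (auto intro!: recfn_diff recfn_pfst recfn_psnd recfn_nth)

lemma computable_prod_encode:
  "computable f \<Longrightarrow> computable g \<Longrightarrow> computable (\<lambda>x. prod_encode (f x, g x))"
  by (rule computable_binary_natI) (auto intro!: recfn_prod_encode recfn_pfst recfn_psnd recfn_nth)

lemma computable_nat_mult [computable_intros]:
  assumes "computable f" "computable g"
  shows "computable (\<lambda>x. f x * g x :: nat)"
proof -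
  have "computable (\<lambda>x. rec_nat 0 (\<lambda>_ r. r + f x) (g x))"
    by (intro computable_intros assms computable_comp[OF assms(1)])
  moreover have "rec_nat 0 (\<lambda>_ r. r + a) b = a * b" for a b :: nat
    by (induction b) simp_all
  ultimately show ?thesis
    by simp
qed

lemma computable_If [computable_intros]:
  assumes "computable b" "computable f" "computable g"
  shows "computable (\<lambda>x. if b x then f x else g x)"
proof -
  obtain B where B: "computable_fun B" "\<And>x. B (encode x) = encode (b x)"
    using assms(1) by (rule computableE) blast
  then have "computable (\<lambda>x. of_bool (b x) :: nat)"
    by (intro computableI[OF B(1)]) (simp add: encode_bool_def)
  \<comment> \<open>Branching is recursion of depth 0 or 1: depth 0 returns the base value
    \<open>g x\<close>, depth 1 the step value \<open>f x\<close>.\<close>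
  then have "computable (\<lambda>x. rec_nat (g x) (\<lambda>_ _. f x) (of_bool (b x)))"
    by (intro computable_intros assms computable_comp[OF assms(2)])
  moreover have "rec_nat (g x) (\<lambda>_ _. f x) (of_bool (b x)) = (if b x then f x else g x)" for x
    by simp
  ultimately show ?thesis
    by simp
qed

lemma computable_nat_eq_0 [computable_intros]:
  assumes "computable f"
  shows "computable (\<lambda>x. f x = (0::nat))"
proof -
  have "computable (\<lambda>x. rec_nat True (\<lambda>_ _. False) (f x))"
    by (intro computable_intros assms)
  moreover have "rec_nat True (\<lambda>_ _. False) n \<longleftrightarrow> n = 0" for n
    by (cases n) simp_all
  ultimately show ?thesis
    by simp
qed

lemma computable_not [computable_intros]:
  assumes "computable f"
  shows "computable (\<lambda>x. \<not> f x)"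
proof -
  have "computable (\<lambda>x. if f x then False else True)"
    by (intro computable_intros assms)
  then show ?thesis
    by (rule back_subst[of computable]) auto
qed

lemma computable_conj [computable_intros]:
  assumes "computable f" "computable g"
  shows "computable (\<lambda>x. f x \<and> g x)"
proof -
  have "computable (\<lambda>x. if f x then g x else False)"
    by (intro computable_intros assms)
  then show ?thesis
    by (rule back_subst[of computable]) auto
qed

lemma computable_disj [computable_intros]:
  assumes "computable f" "computable g"
  shows "computable (\<lambda>x. f x \<or> g x)"
proof -
  have "computable (\<lambda>x. \<not> (\<not> f x \<and> \<not> g x))"
    by (intro computable_intros assms)
  then show ?thesis
    by simp
qed

lemma computable_nat_le [computable_intros]:
  assumes "computable f" "computable g"
  shows "computable (\<lambda>x. f x \<le> (g x :: nat))"
proof -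
  have "computable (\<lambda>x. f x - g x = 0)"
    by (intro computable_intros assms)
  then show ?thesis
    by simp
qed

lemma computable_nat_less [computable_intros]:
  assumes "computable f" "computable g"
  shows "computable (\<lambda>x. f x < (g x :: nat))"
proof -
  have "computable (\<lambda>x. \<not> g x \<le> f x)"
    by (intro computable_intros assms)
  then show ?thesis
    by (simp add: not_le)
qed

lemma computable_Bex_less [computable_intros]:
  fixes n :: "'a::encodable \<Rightarrow> nat"
  assumes "computable n" "computable (\<lambda>p. P (fst p) (snd p))"
  shows "computable (\<lambda>x. \<exists>k<n x. P x k)"
proof -
  have "computable (\<lambda>x. rec_nat False (\<lambda>k r. r \<or> P x k) (n x))"
    by (intro computable_intros assms computable_comp2[OF assms(2)])
  moreover have "rec_nat False (\<lambda>k r. r \<or> P x k) m \<longleftrightarrow> (\<exists>k<m. P x k)" for x m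
    by (induction m) (auto simp: less_Suc_eq)
  ultimately show ?thesis
    by simp
qed

text \<open>
  Only for numerical parameters, since the search has to end on every code, including the numbers
  that do not encode anything.
\<close>

lemma computable_Least:
  fixes P :: "nat \<Rightarrow> nat \<Rightarrow> nat \<Rightarrow> bool"
  assumes P: "computable (\<lambda>p. P (fst (fst p)) (snd (fst p)) (snd p))" and ex: "\<And>a b. \<exists>k. P a b k"
    and fg: "computable f" "computable g"
  shows "computable (\<lambda>x. LEAST k. P (f x) (g x) k)"
proof (rule computable_comp2[OF _ fg])
  have "computable (\<lambda>p. if P (fst (fst p)) (snd (fst p)) (snd p) then 0 else 1::nat)"
    by (intro computable_intros P)
  then obtain H where H: "computable_fun H"
      "\<And>p. H (encode p) = encode (if P (fst (fst p)) (snd (fst p)) (snd p) then 0 else 1::nat)"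
    by (rule computableE) blast
  have H0: "H (prod_encode (z, k)) = 0 \<longleftrightarrow> P (pfst z) (psnd z) k" for z k
    using H(2)[of "((pfst z, psnd z), k)"] by (simp add: encode_prod_def)
  have "computable_fun (\<lambda>z. LEAST k. H (prod_encode (z, k)) = 0)"
    by (intro computable_fun_Least H(1)) (simp add: H0 ex)
  then show "computable (\<lambda>p. LEAST k. P (fst p) (snd p) k)"
    by (rule computableI) (simp add: H0 encode_prod_def)
qed

lemma computable_div [computable_intros]:
  assumes "computable f" "computable g"
  shows "computable (\<lambda>x. f x div (g x :: nat))"
proof -
  \<comment> \<open>The disjunct \<open>g x = 0\<close> keeps the search total and stops it at 0,
    the value of division by 0.\<close>
  have "computable (\<lambda>x. LEAST q. g x = 0 \<or> f x < Suc q * g x)"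
  proof (rule computable_Least[OF _ _ assms])
    show "computable (\<lambda>p. snd (fst p) = (0::nat) \<or> fst (fst p) < Suc (snd p) * snd (fst p))"
      by (intro computable_intros)
    show "\<exists>q. b = 0 \<or> a < Suc q * b" for a b
      by (intro exI[of _ a]) (cases b, simp_all)
  qed
  moreover have "(LEAST q. b = 0 \<or> a < Suc q * b) = a div b" for a b :: nat
  proof (cases "b = 0")
    case False
    then have "a < Suc q * b \<longleftrightarrow> a div b \<le> q" for q
      using div_less_iff_less_mult[of b a "Suc q"] by (simp add: less_Suc_eq_le)
    with False show ?thesis
      by (auto intro: Least_equality)
  qed (simp add: Least_equality)
  ultimately show ?thesis
    by simp
qed

lemma computable_dvd [computable_intros]:
  assumes "computable f" "computable g"
  shows "computable (\<lambda>x. f x dvd (g x :: nat))"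
proof -
  have "computable (\<lambda>x. g x - f x * (g x div f x) = 0)"
    by (intro computable_intros assms)
  moreover have "b - a * (b div a) = 0 \<longleftrightarrow> a dvd b" for a b :: nat
    by (metis dvd_eq_mod_eq_0 minus_mult_div_eq_mod)
  ultimately show ?thesis
    by simp
qed

subsection \<open>Integers and rational numbers\<close>

text \<open>\<open>int_encode\<close> interleaves signs: nonnegative integers have even codes,
  negative ones odd codes. Producing integers as differences of naturals confines this case split to
  one place; sums and products then work on positive and negative parts.\<close>

lemma computable_int_diff:
  assumes "computable f" "computable g"
  shows "computable (\<lambda>x. int (f x) - int (g x))"
proof (rule computable_comp2[OF _ assms])
  have "computable (\<lambda>p. if snd p \<le> fst p then 2 * (fst p - snd p) else Suc (2 * (snd p - fst p - 1)))"
    by (intro computable_intros)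
  then obtain F where F: "computable_fun F"
      "\<And>p. F (encode p) = encode (if snd p \<le> fst p then 2 * (fst p - snd p) else Suc (2 * (snd p - fst p - 1)))"
    by (rule computableE) blast
  have "int_encode (int a - int b) = (if b \<le> a then 2 * (a - b) else Suc (2 * (b - a - 1)))" for a b
  proof (cases "b \<le> a")
    case True
    then have "nat (int a - int b) = a - b" "0 \<le> int a - int b"
      by linarith+
    with True show ?thesis
      by (simp add: int_encode_def sum_encode_def)
  next
    case False
    then have "nat (- (int a - int b) - 1) = b - a - 1" "\<not> 0 \<le> int a - int b"
      by linarith+
    with False show ?thesis
      by (simp only: int_encode_def sum_encode_def if_False sum.case)
  qed
  then show "computable (\<lambda>p. int (fst p) - int (snd p))"
    by (intro computableI[OF F(1)]) (simp only: F(2) encode_int_def encode_nat_def)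
qed

lemma computable_nat_of_int [computable_intros]:
  assumes "computable f"
  shows "computable (\<lambda>x. nat (f x))"
proof (rule computable_comp[OF _ assms])
  have "computable (\<lambda>z::nat. if 2 dvd z then z div 2 else 0)"
    by (intro computable_intros)
  then show "computable nat"
    unfolding computable_nat_iff
    by (rule computableI) (auto simp: encode_int_def int_encode_def sum_encode_def)
qed

lemma computable_nat_of_uminus [computable_intros]:
  assumes "computable f"
  shows "computable (\<lambda>x. nat (- f x))"
proof (rule computable_comp[OF _ assms])
  have "computable (\<lambda>z::nat. if 2 dvd z then 0 else Suc (z div 2))"
    by (intro computable_intros)
  then show "computable (\<lambda>i. nat (- i))"
    unfolding computable_nat_iff
    by (rule computableI) (auto simp: encode_int_def int_encode_def sum_encode_def)
qed

lemma computable_int_add [computable_intros]: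
  assumes "computable f" "computable g"
  shows "computable (\<lambda>x. f x + g x :: int)"
proof -
  have "computable (\<lambda>x. int (nat (f x) + nat (g x)) - int (nat (- f x) + nat (- g x)))"
    by (intro computable_intros computable_int_diff assms)
  moreover have "int (nat a + nat b) - int (nat (- a) + nat (- b)) = a + b" for a b
    by simp
  ultimately show ?thesis
    by (simp only:)
qed

lemma computable_of_nat_int [computable_intros]:
  assumes "computable f"
  shows "computable (\<lambda>x. int (f x))"
  using computable_int_diff[OF assms computable_const[of 0]] by simp

lemma computable_int_mult [computable_intros]:
  assumes "computable f" "computable g"
  shows "computable (\<lambda>x. f x * g x :: int)"
proof -
  have "computable (\<lambda>x. int (nat (f x) * nat (g x) + nat (- f x) * nat (- g x))
      - int (nat (f x) * nat (- g x) + nat (- f x) * nat (g x)))"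
    by (intro computable_intros computable_int_diff assms)
  moreover have "int (nat a * nat b + nat (- a) * nat (- b)) - int (nat a * nat (- b) + nat (- a) * nat b)
      = a * b" for a b
    by (cases "0 \<le> a"; cases "0 \<le> b") (simp_all add: not_le)
  ultimately show ?thesis
    by (simp only:)
qed

lemma computable_int_less [computable_intros]:
  assumes "computable f" "computable g"
  shows "computable (\<lambda>x. f x < (g x :: int))"
proof -
  have "computable (\<lambda>x. nat (f x) + nat (- g x) < nat (g x) + nat (- f x))"
    by (intro computable_intros assms)
  moreover have "nat a + nat (- b) < nat b + nat (- a) \<longleftrightarrow> a < b" for a b
    by linarith
  ultimately show ?thesis
    by (simp only:)
qed

definition numer :: "rat \<Rightarrow> int" where "numer q = fst (quotient_of q)"
definition denom :: "rat \<Rightarrow> nat" where "denom q = nat (snd (quotient_of q))"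

lemma encode_rat_eq: "encode q = prod_encode (encode (numer q), denom q)"
  by (simp add: encode_rat_def rat_encode_def encode_int_def numer_def denom_def)

lemma denom_pos: "0 < denom q"
  using quotient_of_denom_pos' [of q] by (simp add: denom_def)

lemma rat_eq_numer_denom: "q = of_int (numer q) / of_nat (denom q)"
  using quotient_of_denom_pos'[of q] quotient_of_div[of q "fst (quotient_of q)" "snd (quotient_of q)"]
  by (simp add: numer_def denom_def)

lemma computable_numer [computable_intros]:
  assumes "computable f"
  shows "computable (\<lambda>x. numer (f x))"
  by (rule computable_comp[OF computableI[OF computable_fun_pfst] assms]) (simp add: encode_rat_eq)

lemma computable_denom [computable_intros]:
  assumes "computable f"
  shows "computable (\<lambda>x. denom (f x))"
  by (rule computable_comp[OF computableI[OF computable_fun_psnd] assms]) (simp add: encode_rat_eq)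


lemma computable_ratI:
  assumes "computable (\<lambda>x. numer (f x))" "computable (\<lambda>x. denom (f x))"
  shows "computable f"
proof -
  obtain F where F: "computable_fun F" "\<And>x. F (encode x) = encode (numer (f x), denom (f x))"
    using computable_Pair[OF assms] by (rule computableE) blast
  show ?thesis
    by (rule computableI[OF F(1)]) (simp add: F(2) encode_rat_eq)
qed

lemma numer_denom_divide:
  fixes n :: int and d :: nat
  assumes "d \<noteq> 0"
  defines "q \<equiv> of_int n / of_nat d"
  shows "numer q * int d = n * int (denom q)" "coprime (numer q) (int (denom q))"
proof -
  have "(of_int (numer q * int d) :: rat) = of_int (n * int (denom q))"
    using rat_eq_numer_denom[of q] assms denom_pos[of q] by (simp add: q_def field_simps)
  then show "numer q * int d = n * int (denom q)"
    by (simp only: of_int_eq_iff)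
  show "coprime (numer q) (int (denom q))"
    using quotient_of_coprime[of q "fst (quotient_of q)" "snd (quotient_of q)"] quotient_of_denom_pos'[of q]
    by (simp add: numer_def denom_def)
qed

text \<open>Codes of rationals are reduced fractions, so arithmetic has to reduce. Instead of a gcd,
  the reduced denominator is found by minimization as the smallest positive factor that makes the
  fraction integral. For \<open>d = 0\<close> the search ends at 1, the denominator of 0.\<close>

lemma denom_divide:
  fixes n :: int and d :: nat
  shows "denom (of_int n / of_nat d) = (LEAST b. 0 < b \<and> (d = 0 \<or> d dvd nat \<bar>n\<bar> * b))"
proof (cases "d = 0")
  case True
  then show ?thesis
    by (auto simp: denom_def intro!: Least_equality[symmetric])
next
  case False
  let ?q = "of_int n / of_nat d :: rat"
  note nd = numer_denom_divide[OF False, of n]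
  show ?thesis
  proof (rule Least_equality[symmetric], goal_cases)
    case 1
    have "int d dvd n * int (denom ?q)"
      by (metis nd(1) dvd_triv_right)
    then have "d dvd nat \<bar>n * int (denom ?q)\<bar>"
      by simp
    then show ?case
      using denom_pos[of ?q] by (simp add: abs_mult nat_mult_distrib)
  next
    case (2 b)
    then have "d dvd nat \<bar>n * int b\<bar>"
      using False by (simp add: abs_mult nat_mult_distrib)
    then have "int d dvd n * int b"
      by simp
    then obtain a where a: "n * int b = int d * a"
      by blast
    have "(numer ?q * int b) * int d = (a * int (denom ?q)) * int d"
      by (metis a nd(1) mult.commute mult.left_commute)
    then have "numer ?q * int b = a * int (denom ?q)"
      using False by simp
    then have "int (denom ?q) dvd numer ?q * int b"
      by simp
    then have "int (denom ?q) dvd int b"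
      using nd(2) by (metis coprime_commute coprime_dvd_mult_right_iff)
    then show ?case
      using 2 by (simp add: dvd_imp_le)
  qed
qed

text \<open>Once the reduced denominator is known, the numerator is an exact quotient. It is split
  by sign because division is computed on naturals.\<close>

lemma numer_divide:
  fixes n :: int and d :: nat
  defines "b \<equiv> denom (of_int n / of_nat d)"
  shows "numer (of_int n / of_nat d) = int (nat n * b div d) - int (nat (- n) * b div d)"
proof (cases "d = 0")
  case True
  then show ?thesis
    by (simp add: numer_def)
next
  case False
  have "numer (of_int n / of_nat d) * int d = n * int b"
    unfolding b_def using False by (rule numer_denom_divide)
  then have "numer (of_int n / of_nat d) = n * int b div int d"
    by (metis False nonzero_mult_div_cancel_right of_nat_eq_0_iff)
  moreover have "(- n) * int b div int d = - (n * int b div int d)"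
    by (metis \<open>numer _ * int d = n * int b\<close> dvd_triv_right minus_mult_left neg_equal_iff_equal dvd_neg_div)
  ultimately show ?thesis
    by (cases "0 \<le> n") (simp_all add: zdiv_int)
qed

lemma computable_rat_divide:
  fixes n :: "'a::encodable \<Rightarrow> int" and d :: "'a \<Rightarrow> nat"
  assumes "computable n" "computable d"
  shows "computable (\<lambda>x. of_int (n x) / of_nat (d x) :: rat)"
proof (rule computable_ratI)
  have abs: "nat \<bar>k\<bar> = nat k + nat (- k)" for k
    by simp
  have "computable (\<lambda>x. LEAST b. 0 < b \<and> (d x = 0 \<or> d x dvd (nat (n x) + nat (- n x)) * b))"
  proof (rule computable_Least)
    show "computable (\<lambda>p::(nat \<times> nat) \<times> nat. 0 < snd p \<and> (fst (fst p) = 0 \<or> fst (fst p) dvd snd (fst p) * snd p))"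
      by (intro computable_intros)
    show "\<exists>k. 0 < k \<and> (a = 0 \<or> a dvd b * k)" for a b :: nat
      by (intro exI[of _ "if a = 0 then 1 else a"]) simp
  qed (intro computable_intros assms)+
  then show *: "computable (\<lambda>x. denom (of_int (n x) / of_nat (d x)))"
    by (simp only: denom_divide abs)
  show "computable (\<lambda>x. numer (of_int (n x) / of_nat (d x)))"
    unfolding numer_divide by (intro computable_int_diff computable_intros * assms)
qed

lemma computable_rat_add [computable_intros]:
  assumes "computable f" "computable g"
  shows "computable (\<lambda>x. f x + g x :: rat)"
proof -
  have "computable (\<lambda>x. of_int (numer (f x) * int (denom (g x)) + numer (g x) * int (denom (f x)))
      / of_nat (denom (f x) * denom (g x)) :: rat)"
    by (intro computable_rat_divide computable_intros assms)
  moreover have "of_int (numer p * int (denom q) + numer q * int (denom p)) / of_nat (denom p * denom q) = p + q" for p q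
    using rat_eq_numer_denom[of p] rat_eq_numer_denom[of q] denom_pos[of p] denom_pos[of q]
    by (metis (no_types, lifting) add_frac_eq not_less_zero of_int_add of_int_mult of_int_of_nat_eq of_nat_eq_0_iff of_nat_mult)
  ultimately show ?thesis
    by (simp only:)
qed

lemma computable_rat_mult [computable_intros]:
  assumes "computable f" "computable g"
  shows "computable (\<lambda>x. f x * g x :: rat)"
proof -
  have "computable (\<lambda>x. of_int (numer (f x) * numer (g x)) / of_nat (denom (f x) * denom (g x)) :: rat)"
    by (intro computable_rat_divide computable_intros assms)
  moreover have "of_int (numer p * numer q) / of_nat (denom p * denom q) = p * q" for p q
    using rat_eq_numer_denom[of p] rat_eq_numer_denom[of q]
    by (metis of_int_mult of_nat_mult times_divide_times_eq)
  ultimately show ?thesis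
    by (simp only:)
qed

lemma computable_rat_uminus [computable_intros]:
  assumes "computable f"
  shows "computable (\<lambda>x. - f x :: rat)"
  using computable_rat_mult[OF computable_const[of "-1"] assms] by simp

lemma computable_rat_diff [computable_intros]:
  assumes "computable f" "computable g"
  shows "computable (\<lambda>x. f x - g x :: rat)"
  using computable_rat_add[OF assms(1) computable_rat_uminus[OF assms(2)]] by simp

lemma computable_rat_less [computable_intros]:
  assumes "computable f" "computable g"
  shows "computable (\<lambda>x. f x < (g x :: rat))"
proof -
  have "computable (\<lambda>x. numer (f x) * int (denom (g x)) < numer (g x) * int (denom (f x)))"
    by (intro computable_intros assms)
  moreover have "numer p * int (denom q) < numer q * int (denom p) \<longleftrightarrow> p < q" for p q
  proof -
    have "of_int a / of_nat b < (of_int c / of_nat d :: rat) \<longleftrightarrow>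
        of_int (a * int d) < (of_int (c * int b) :: rat)" if "0 < b" "0 < d" for a b c d
      using that by (simp add: field_simps)
    from this[OF denom_pos denom_pos, of "numer p" p "numer q" q]
    have "p < q \<longleftrightarrow> of_int (numer p * int (denom q)) < (of_int (numer q * int (denom p)) :: rat)"
      by (simp only: rat_eq_numer_denom[symmetric])
    then show ?thesis
      by (simp only: of_int_less_iff)
  qed
  ultimately show ?thesis
    by (simp only:)
qed

lemma computable_rat_le [computable_intros]:
  assumes "computable f" "computable g"
  shows "computable (\<lambda>x. f x \<le> (g x :: rat))"
  using computable_not[OF computable_rat_less[OF assms(2,1)]] by (simp add: not_less)

lemma computable_rat_abs [computable_intros]:
  assumes "computable f"
  shows "computable (\<lambda>x. \<bar>f x\<bar> :: rat)"
  unfolding abs_if by (intro computable_intros assms)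

lemma computable_rat_power [computable_intros]:
  assumes "computable f" "computable n"
  shows "computable (\<lambda>x. f x ^ n x :: rat)"
proof -
  have "computable (\<lambda>x. rec_nat 1 (\<lambda>_ r. f x * r) (n x))"
    by (intro computable_intros assms computable_comp[OF assms(1)])
  moreover have "rec_nat 1 (\<lambda>_ r. q * r) k = q ^ k" for q :: rat and k
    by (induction k) simp_all
  ultimately show ?thesis
    by (simp only:)
qed

lemma computable_rat_sum [computable_intros]:
  fixes h :: "'a::encodable \<Rightarrow> nat \<Rightarrow> rat"
  assumes "computable n" "computable (\<lambda>p. h (fst p) (snd p))"
  shows "computable (\<lambda>x. \<Sum>i<n x. h x i)"
proof -
  have "computable (\<lambda>x. rec_nat 0 (\<lambda>k r. r + h x k) (n x))"
    by (intro computable_intros assms computable_comp2[OF assms(2)])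
  moreover have "rec_nat 0 (\<lambda>k r. r + h x k) m = (\<Sum>i<m. h x i)" for x m
    by (induction m) simp_all
  ultimately show ?thesis
    by (simp only:)
qed

subsection \<open>Lists\<close>

lemma computable_Cons [computable_intros]:
  assumes "computable f" "computable xs"
  shows "computable (\<lambda>x. f x # xs x)"
proof -
  obtain F where F: "computable_fun F" "\<And>x. F (encode x) = encode (f x, xs x)"
    using computable_Pair[OF assms] by (rule computableE) blast
  have "computable_fun (\<lambda>x. Suc (F x))"
    using computable_Suc[of F] F(1) by (simp add: computable_nat_iff)
  then show ?thesis
    by (rule computableI) (simp add: F(2))
qed

lemma computable_case_list [computable_intros]:
  assumes "computable xs" "computable d"
    and "computable (\<lambda>p. h (fst p) (fst (snd p)) (snd (snd p)))"
  shows "computable (\<lambda>x. case xs x of [] \<Rightarrow> d x | y # ys \<Rightarrow> h x y ys)"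
proof -
  obtain X where X: "computable_fun X" "\<And>x. X (encode x) = encode (xs x)"
    using assms(1) by (rule computableE) blast
  obtain D where D: "computable_fun D" "\<And>x. D (encode x) = encode (d x)"
    using assms(2) by (rule computableE) blast
  obtain H where H: "computable_fun H"
      "\<And>p. H (encode p) = encode (h (fst p) (fst (snd p)) (snd (snd p)))"
    using assms(3) by (rule computableE) blast
  note nat = X(1)[folded computable_nat_iff] D(1)[folded computable_nat_iff] H(1)[folded computable_nat_iff]
  \<comment> \<open>The empty list has code 0 and a nonempty one the successor of a pair code, so
    \<open>X z - 1\<close> already pairs the codes of head and tail, and nothing needs
    decoding.\<close>
  have "computable (\<lambda>z. if X z = 0 then D z else H (prod_encode (z, X z - 1)))"
    by (intro computable_intros nat computable_comp[OF nat(3)] computable_prod_encode)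
  then have "computable_fun (\<lambda>z. if X z = 0 then D z else H (prod_encode (z, X z - 1)))"
    by (simp only: computable_nat_iff)
  then show ?thesis
  proof (rule computableI)
    fix x
    show "(if X (encode x) = 0 then D (encode x) else H (prod_encode (encode x, X (encode x) - 1)))
        = encode (case xs x of [] \<Rightarrow> d x | y # ys \<Rightarrow> h x y ys)"
      using H(2)[of "(x, y, ys)" for y ys] by (cases "xs x") (simp_all add: X D)
  qed
qed

text \<open>List recursion is simulated by a loop with a numerical bound; the code itself is a bound
  that is always at hand.\<close>

lemma length_le_encode: "length xs \<le> encode xs"
proof (induction xs)
  case (Cons x xs)
  then show ?case
    using le_prod_encode_2[of "encode xs" "encode x"] by simp
qed simp

lemma computable_fold [computable_intros]:
  assumes "computable xs" "computable a"
    and "computable (\<lambda>p. h (fst p) (fst (snd p)) (snd (snd p)))"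
  shows "computable (\<lambda>x. fold (h x) (xs x) (a x))"
proof -
  obtain X where X: "computable_fun X" "\<And>x. X (encode x) = encode (xs x)"
    using assms(1) by (rule computableE) blast
  obtain A where A: "computable_fun A" "\<And>x. A (encode x) = encode (a x)"
    using assms(2) by (rule computableE) blast
  obtain H where H: "computable_fun H"
      "\<And>p. H (encode p) = encode (h (fst p) (fst (snd p)) (snd (snd p)))"
    using assms(3) by (rule computableE) blast
  note nat = X(1)[folded computable_nat_iff] A(1)[folded computable_nat_iff] H(1)[folded computable_nat_iff]
  \<comment> \<open>The state consists of the code of the unread rest and the accumulator. It is
    stationary once the rest is 0, so surplus iterations do no harm.\<close>
  define step where "step z s = (if fst s = 0 then s else
    (psnd (fst s - 1), H (prod_encode (z, prod_encode (pfst (fst s - 1), snd s)))))" for z and s :: "nat \<times> nat"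
  have "computable (\<lambda>z. snd (rec_nat (X z, A z) (\<lambda>_. step z) (X z)))"
    unfolding step_def
    by (intro computable_intros nat computable_comp[OF nat(3)]
        computable_prod_encode)
  then have "computable_fun (\<lambda>z. snd (rec_nat (X z, A z) (\<lambda>_. step z) (X z)))"
    by (simp only: computable_nat_iff)
  then show ?thesis
  proof (rule computableI)
    fix x
    have *: "rec_nat s (\<lambda>_. step z) m = (step z ^^ m) s" for s z m
      by (induction m) simp_all
    have fix0: "(step z ^^ m) (0, c) = (0, c)" for z m c
      by (induction m) (simp_all add: step_def)
    have "length ys \<le> m \<Longrightarrow> (step (encode x) ^^ m) (encode ys, encode c) = (0, encode (fold (h x) ys c))"
      for ys c m
    proof (induction ys arbitrary: c m)
      case (Cons y ys)
      then obtain m' where m: "m = Suc m'" "length ys \<le> m'"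
        by (cases m) auto
      have "step (encode x) (encode (y # ys), encode c) = (encode ys, encode (h x y c))"
        using H(2)[of "(x, y, c)"] by (simp add: step_def)
      then show ?case
        by (simp only: m(1) funpow_Suc_right comp_apply Cons.IH[OF m(2)] fold_simps)
    qed (simp add: fix0)
    then show "snd (rec_nat (X (encode x), A (encode x)) (\<lambda>_. step (encode x)) (X (encode x)))
        = encode (fold (h x) (xs x) (a x))"
      by (simp add: * X A length_le_encode)
  qed
qed

lemma computable_rev [computable_intros]:
  assumes "computable xs"
  shows "computable (\<lambda>x. rev (xs x))"
proof -
  have "computable (\<lambda>x. fold (\<lambda>y ys. y # ys) (xs x) [])"
    by (intro computable_intros assms)
  then show ?thesis
    by (simp add: rev_conv_fold)
qed

lemma computable_append [computable_intros]:
  assumes "computable xs" "computable ys"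
  shows "computable (\<lambda>x. xs x @ ys x)"
proof -
  have "computable (\<lambda>x. fold (\<lambda>y ys. y # ys) (rev (xs x)) (ys x))"
    by (intro computable_intros assms)
  moreover have "fold (\<lambda>y ys. y # ys) (rev us) vs = us @ vs" for us vs :: "'b list"
    by (induction us arbitrary: vs) simp_all
  ultimately show ?thesis
    by simp
qed

lemma computable_map [computable_intros]:
  assumes "computable xs" "computable (\<lambda>p. h (fst p) (snd p))"
  shows "computable (\<lambda>x. map (h x) (xs x))"
proof -
  have "computable (\<lambda>x. rev (fold (\<lambda>y ys. h x y # ys) (xs x) []))"
    by (intro computable_intros assms computable_comp2[OF assms(2)])
  moreover have "rev (fold (\<lambda>y ys. h x y # ys) us vs) = rev vs @ map (h x) us" for x us vs
    by (induction us arbitrary: vs) simp_all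
  ultimately show ?thesis
    by simp
qed

lemma computable_concat [computable_intros]:
  assumes "computable xss"
  shows "computable (\<lambda>x. concat (xss x))"
proof -
  have "computable (\<lambda>x. fold (\<lambda>xs ys. ys @ xs) (xss x) [])"
    by (intro computable_intros assms)
  moreover have "fold (\<lambda>xs ys. ys @ xs) us vs = vs @ concat us" for us and vs :: "'b list"
    by (induction us arbitrary: vs) simp_all
  ultimately show ?thesis
    by simp
qed

lemma computable_product_lists [computable_intros]:
  assumes "computable xss"
  shows "computable (\<lambda>x. product_lists (xss x))"
proof -
  have "computable (\<lambda>x. fold (\<lambda>xs acc. concat (map (\<lambda>y. map (\<lambda>ys. y # ys) acc) xs)) (rev (xss x)) [[]])"
    by (intro computable_intros assms)
  moreover have "fold (\<lambda>xs acc. concat (map (\<lambda>y. map (\<lambda>ys. y # ys) acc) xs)) (rev us) [[]] = product_lists us"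
    for us :: "'b list list"
    by (induction us) simp_all
  ultimately show ?thesis
    by simp
qed

lemma computable_Ball_set [computable_intros]:
  assumes "computable xs" "computable (\<lambda>p. P (fst p) (snd p))"
  shows "computable (\<lambda>x. \<forall>y\<in>set (xs x). P x y)"
proof -
  have "computable (\<lambda>x. fold (\<lambda>y b. b \<and> P x y) (xs x) True)"
    by (intro computable_intros assms computable_comp2[OF assms(2)])
  moreover have "fold (\<lambda>y b. b \<and> P x y) us c \<longleftrightarrow> c \<and> (\<forall>y\<in>set us. P x y)" for x us c
    by (induction us arbitrary: c) auto
  ultimately show ?thesis
    by simp
qed

lemma computable_Bex_set [computable_intros]:
  assumes "computable xs" "computable (\<lambda>p. P (fst p) (snd p))"
  shows "computable (\<lambda>x. \<exists>y\<in>set (xs x). P x y)"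
proof -
  have "computable (\<lambda>x. \<not> (\<forall>y\<in>set (xs x). \<not> P x y))"
    by (intro computable_intros assms)
  then show ?thesis
    by simp
qed

lemma computable_length [computable_intros]:
  assumes "computable xs"
  shows "computable (\<lambda>x. length (xs x))"
proof -
  have "computable (\<lambda>x. fold (\<lambda>_ n. Suc n) (xs x) 0)"
    by (intro computable_intros assms)
  moreover have "fold (\<lambda>_ n. Suc n) us n = n + length us" for us :: "'b list" and n
    by (induction us arbitrary: n) simp_all
  ultimately show ?thesis
    by simp
qed

lemma computable_drop [computable_intros]:
  assumes "computable xs" "computable n"
  shows "computable (\<lambda>x. drop (n x) (xs x))"
proof -
  have "computable (\<lambda>x. rec_nat (xs x) (\<lambda>_ ys. case ys of [] \<Rightarrow> [] | _ # zs \<Rightarrow> zs) (n x))"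
    by (intro computable_intros assms)
  moreover have "rec_nat us (\<lambda>_ ys. case ys of [] \<Rightarrow> [] | _ # zs \<Rightarrow> zs) m = drop m us" for us :: "'b list" and m
  proof (induction m)
    case (Suc m)
    have "drop (Suc m) us = tl (drop m us)"
      by (simp add: drop_Suc tl_drop)
    then show ?case
      by (cases "drop m us") (simp_all add: Suc)
  qed simp
  ultimately show ?thesis
    by simp
qed

section \<open>Embeddings as limits of approximate embeddings\<close>

context Metric_space
begin

text \<open>Total boundedness supplies finite nets of mesh \<open>1 / Suc n\<close>; their countable
  union is enumerated, with repetitions if it is finite.\<close>

lemma compactin_dense_sequence:
  assumes X: "compactin mtopology X" and ne: "X \<noteq> {}"
  obtains x :: "nat \<Rightarrow> 'a" where "range x \<subseteq> X" "\<And>p \<delta>. p \<in> X \<Longrightarrow> 0 < \<delta> \<Longrightarrow> \<exists>i. d p (x i) < \<delta>"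
proof -
  have tb: "mtotally_bounded X"
    using X by (rule compactin_imp_mtotally_bounded)
  have "\<exists>K. finite K \<and> K \<subseteq> X \<and> X \<subseteq> (\<Union>x\<in>K. mball x (1 / Suc n))" for n :: nat
    using tb unfolding mtotally_bounded_def by simp
  then obtain K where K: "\<And>n. finite (K n)" "\<And>n. K n \<subseteq> X"
      "\<And>n::nat. X \<subseteq> (\<Union>x\<in>K n. mball x (1 / Suc n))"
    by metis
  have cov: "\<exists>q\<in>K n. d p q < 1 / Suc n" if p: "p \<in> X" for p n
  proof -
    obtain q where "q \<in> K n" "p \<in> mball q (1 / Suc n)"
      using K(3)[of n] p by blast
    then show ?thesis
      using commute[of p q] by (metis in_mball)
  qed
  let ?K = "\<Union>n. K n"
  have "countable ?K"
    by (intro countable_UN) (auto intro: countable_finite K)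
  moreover have "?K \<noteq> {}"
    using cov ne by blast
  ultimately have rng: "range (from_nat_into ?K) = ?K"
    by (rule range_from_nat_into[rotated])
  show thesis
  proof
    show "range (from_nat_into ?K) \<subseteq> X"
      unfolding rng using K(2) by blast
    fix p and \<delta> :: real assume p: "p \<in> X" and "0 < \<delta>"
    then obtain n where n: "1 / Suc n < \<delta>"
      using nat_approx_posE by blast
    obtain q where "q \<in> K n" "d p q < 1 / Suc n"
      using cov[OF p] by blast
    moreover obtain i where "q = from_nat_into ?K i"
      using rng \<open>q \<in> K n\<close> by blast
    ultimately show "\<exists>i. d p (from_nat_into ?K i) < \<delta>"
      using n by (intro exI[of _ i]) simp
  qed
qed

text \<open>A single subsequence has to serve all \<open>i\<close>, because the moduli compare the
  limits belonging to different indices.\<close>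

lemma compactin_diagonal:
  fixes y :: "nat \<Rightarrow> nat \<Rightarrow> 'a"
  assumes Y: "compactin mtopology Y" and y: "\<And>i k. y i k \<in> Y"
  obtains r l where "strict_mono r" "\<And>i. l i \<in> Y" "\<And>i. (\<lambda>k. d (y i (r k)) (l i)) \<longlonglongrightarrow> 0"
proof -
  define P where "P i r \<longleftrightarrow> (\<exists>l\<in>Y. (\<lambda>k. d (y i (r k)) l) \<longlonglongrightarrow> 0)" for i and r :: "nat \<Rightarrow> nat"
  have YM: "Y \<subseteq> M"
    using Y by (simp add: compactin_sequentially)
  interpret subseqs P
  proof
    fix i and s :: "nat \<Rightarrow> nat" assume "strict_mono s"
    have "range (\<lambda>k. y i (s k)) \<subseteq> Y"
      using y by blast
    then obtain l r where "l \<in> Y" "strict_mono r" "limitin mtopology ((\<lambda>k. y i (s k)) \<circ> r) l sequentially"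
      using Y unfolding compactin_sequentially by metis
    then have "(\<lambda>k. d (y i (s (r k))) l) \<longlonglongrightarrow> 0"
      by (simp add: limitin_metric_dist_null comp_def)
    then show "\<exists>r'. strict_mono r' \<and> P i (s \<circ> r')"
      using \<open>l \<in> Y\<close> \<open>strict_mono r\<close> unfolding P_def comp_def by blast
  qed
  have "P i diagseq" for i
  proof -
    \<comment> \<open>The diagonal sequence refines the \<open>i\<close>-th chosen subsequence only
      from position \<open>Suc i\<close> on; the shift is removed afterwards, since finitely many
      terms do not affect a limit.\<close>
    have "P i (diagseq \<circ> ((+) (Suc i)))"
    proof (rule diagseq_holds)
      fix r s :: "nat \<Rightarrow> nat" and i assume "strict_mono r" "P i s"
      then show "P i (s \<circ> r)"
        unfolding P_def comp_def using LIMSEQ_subseq_LIMSEQ[of "\<lambda>k. d (y i (s k)) l" for l]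
        by (fastforce simp: comp_def)
    qed
    then obtain l where l: "l \<in> Y" "(\<lambda>k. d (y i (diagseq (k + Suc i))) l) \<longlonglongrightarrow> 0"
      unfolding P_def comp_def by (auto simp: add.commute)
    have "(\<lambda>k. d (y i (diagseq k)) l) \<longlonglongrightarrow> 0"
      by (rule LIMSEQ_offset[OF l(2)])
    with l(1) show ?thesis
      unfolding P_def by blast
  qed
  then have "\<forall>i. \<exists>l. l \<in> Y \<and> (\<lambda>k. d (y i (diagseq k)) l) \<longlonglongrightarrow> 0"
    unfolding P_def by blast
  from choice[OF this] obtain l where "\<forall>i. l i \<in> Y \<and> (\<lambda>k. d (y i (diagseq k)) (l i)) \<longlonglongrightarrow> 0"
    by (rule exE)
  then have "\<And>i. l i \<in> Y" "\<And>i. (\<lambda>k. d (y i (diagseq k)) (l i)) \<longlonglongrightarrow> 0"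
    by blast+
  with subseq_diagseq show thesis
    by (rule that)
qed

section \<open>Homeomorphisms from uniform estimates\<close>

lemma continuous_map_subtopologyI:
  assumes "A \<subseteq> M" "f ` A \<subseteq> B" "B \<subseteq> M"
    and "\<And>\<epsilon>. 0 < \<epsilon> \<Longrightarrow> \<exists>\<delta>>0. \<forall>p\<in>A. \<forall>q\<in>A. d p q < \<delta> \<longrightarrow> d (f p) (f q) < \<epsilon>"
  shows "continuous_map (subtopology mtopology A) (subtopology mtopology B) f"
proof -
  have "continuous_map (subtopology mtopology A) mtopology f"
    unfolding continuous_map_to_metric
  proof (intro ballI allI impI)
    fix p and \<epsilon> :: real assume p: "p \<in> topspace (subtopology mtopology A)" and "0 < \<epsilon>"
    then obtain \<delta> where \<delta>: "0 < \<delta>" "\<forall>p\<in>A. \<forall>q\<in>A. d p q < \<delta> \<longrightarrow> d (f p) (f q) < \<epsilon>"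
      using assms(4) by blast
    show "\<exists>U. openin (subtopology mtopology A) U \<and> p \<in> U \<and> (\<forall>q\<in>U. f q \<in> mball (f p) \<epsilon>)"
    proof (intro exI[of _ "mball p \<delta> \<inter> A"] conjI ballI)
      show "openin (subtopology mtopology A) (mball p \<delta> \<inter> A)"
        by (intro openin_subtopology_Int openin_mball)
    qed (use p \<delta> assms(1-3) in \<open>auto simp: in_mball\<close>)
  qed
  then show ?thesis
    using assms(2) by (auto simp: continuous_map_in_subtopology)
qed

text \<open>The embedding is the closure of the correspondence between the two sequences.\<close>

lemma dense_sequence_embedding:
  fixes x y :: "nat \<Rightarrow> 'a"
  assumes X: "X \<subseteq> M" and Y: "compactin mtopology Y"
    and x: "range x \<subseteq> X" and y: "range y \<subseteq> Y"
    and dense: "\<And>p \<delta>. p \<in> X \<Longrightarrow> 0 < \<delta> \<Longrightarrow> \<exists>i. d p (x i) < \<delta>"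
    and xy: "\<And>\<epsilon>. 0 < \<epsilon> \<Longrightarrow> \<exists>\<delta>>0. \<forall>i j. d (x i) (x j) < \<delta> \<longrightarrow> d (y i) (y j) \<le> \<epsilon>"
    and yx: "\<And>\<epsilon>. 0 < \<epsilon> \<Longrightarrow> \<exists>\<delta>>0. \<forall>i j. d (y i) (y j) < \<delta> \<longrightarrow> d (x i) (x j) \<le> \<epsilon>"
  obtains E where "E \<subseteq> Y" "\<And>e \<delta>. e \<in> E \<Longrightarrow> 0 < \<delta> \<Longrightarrow> \<exists>i. d e (y i) < \<delta>"
    "subtopology mtopology E homeomorphic_space subtopology mtopology X"
proof -
  have YM: "Y \<subseteq> M"
    using Y by (simp add: compactin_sequentially)
  define R where "R p q \<longleftrightarrow> p \<in> X \<and> q \<in> Y \<and> (\<forall>\<delta>>0. \<exists>i. d p (x i) < \<delta> \<and> d q (y i) < \<delta>)" for p q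
  \<comment> \<open>Stated for arbitrary sequences and an arbitrary relation, so that one estimate
    serves both \<open>R\<close> and its converse.\<close>
  have unif: "\<exists>\<delta>>0. \<forall>p p' q q'. S p q \<longrightarrow> S p' q' \<longrightarrow> d p p' < \<delta> \<longrightarrow> d q q' < \<epsilon>"
    if uv: "\<And>\<epsilon>. 0 < \<epsilon> \<Longrightarrow> \<exists>\<delta>>0. \<forall>i j. d (u i) (u j) < \<delta> \<longrightarrow> d (v i) (v j) \<le> \<epsilon>"
      and S: "\<And>p q. S p q \<Longrightarrow> p \<in> M \<and> q \<in> M \<and> (\<forall>\<delta>>0. \<exists>i. d p (u i) < \<delta> \<and> d q (v i) < \<delta>)"
      and u: "range u \<subseteq> M" and v: "range v \<subseteq> M" and "0 < \<epsilon>" for S \<epsilon> and u v :: "nat \<Rightarrow> 'a"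
  proof -
    obtain \<delta> where \<delta>: "0 < \<delta>" "\<And>i j. d (u i) (u j) < \<delta> \<Longrightarrow> d (v i) (v j) \<le> \<epsilon> / 2"
      using uv[of "\<epsilon> / 2"] \<open>0 < \<epsilon>\<close> by auto
    have "d q q' < \<epsilon>" if pq: "S p q" "S p' q'" "d p p' < \<delta> / 2" for p p' q q'
    proof -
      \<comment> \<open>Quarters leave room for two error terms each time:
        \<open>\<delta> / 2 + 2 * \<eta> \<le> \<delta>\<close> and
        \<open>\<epsilon> / 2 + 2 * \<eta> \<le> \<epsilon>\<close>.\<close>
      define \<eta> where "\<eta> = min (\<delta> / 4) (\<epsilon> / 4)"
      have "0 < \<eta>"
        using \<delta>(1) \<open>0 < \<epsilon>\<close> by (simp add: \<eta>_def)
      then obtain i j where i: "d p (u i) < \<eta>" "d q (v i) < \<eta>" and j: "d p' (u j) < \<eta>" "d q' (v j) < \<eta>"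
        using S[OF pq(1)] S[OF pq(2)] by blast
      have M: "p \<in> M" "q \<in> M" "p' \<in> M" "q' \<in> M" "u i \<in> M" "u j \<in> M" "v i \<in> M" "v j \<in> M"
        using S[OF pq(1)] S[OF pq(2)] u v by auto
      have "d (u i) (u j) \<le> d p (u i) + d p p' + d p' (u j)"
        using triangle[OF M(5,1,6)] triangle[OF M(1,3,6)] commute[of "u i" p] by linarith
      then have "d (u i) (u j) < \<delta>"
        using i j pq(3) by (simp add: \<eta>_def)
      then have "d (v i) (v j) \<le> \<epsilon> / 2"
        by (rule \<delta>(2))
      moreover have "d q q' \<le> d q (v i) + d (v i) (v j) + d q' (v j)"
        using triangle[OF M(2,7,4)] triangle[OF M(7,8,4)] commute[of "v j" q'] by linarith
      ultimately show ?thesis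
        using i j by (simp add: \<eta>_def)
    qed
    with \<delta>(1) show ?thesis
      by (intro exI[of _ "\<delta> / 2"]) auto
  qed
  have RXY: "\<exists>\<delta>>0. \<forall>p p' q q'. R p q \<longrightarrow> R p' q' \<longrightarrow> d p p' < \<delta> \<longrightarrow> d q q' < \<epsilon>" if "0 < \<epsilon>" for \<epsilon>
    by (rule unif[OF xy _ _ _ that]) (use X YM x y in \<open>auto simp: R_def\<close>)
  have RYX: "\<exists>\<delta>>0. \<forall>q q' p p'. R p q \<longrightarrow> R p' q' \<longrightarrow> d q q' < \<delta> \<longrightarrow> d p p' < \<epsilon>" if "0 < \<epsilon>" for \<epsilon>
    by (rule unif[of y x "\<lambda>q p. R p q", OF yx _ _ _ that]) (use X YM x y in \<open>auto simp: R_def\<close>)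
  \<comment> \<open>With equal first arguments and \<open>\<epsilon> = d q q'\<close> the uniform
    estimate yields \<open>d q q' < d q q'\<close>.\<close>
  have fun_R: "q = q'" if "R p q" "R p q'" for p q q'
  proof (rule ccontr)
    assume "q \<noteq> q'"
    have M: "p \<in> M" "q \<in> M" "q' \<in> M"
      using that X YM by (auto simp: R_def)
    with \<open>q \<noteq> q'\<close> have "0 < d q q'"
      by simp
    from RXY[OF this] that M show False
      by (metis less_irrefl mdist_zero)
  qed
  have inj_R: "p = p'" if "R p q" "R p' q" for p p' q
  proof (rule ccontr)
    assume "p \<noteq> p'"
    have M: "p \<in> M" "p' \<in> M" "q \<in> M"
      using that X YM by (auto simp: R_def)
    with \<open>p \<noteq> p'\<close> have "0 < d p p'"
      by simp
    from RYX[OF this] that M show False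
      by (metis less_irrefl mdist_zero)
  qed
  have total: "\<exists>q. R p q" if p: "p \<in> X" for p
  proof -
    \<comment> \<open>A value at \<open>p\<close> comes from compactness of \<open>Y\<close>: terms
      of \<open>x\<close> converge to \<open>p\<close>, and the matching terms of \<open>y\<close>
      have a cluster point.\<close>
    have "\<exists>i. d p (x i) < (1/2) ^ k" for k
      using dense[OF p, of "(1/2) ^ k"] by simp
    then obtain i where i: "\<And>k. d p (x (i k)) < (1/2) ^ k"
      by metis
    have "range (\<lambda>k. y (i k)) \<subseteq> Y"
      using y by blast
    then obtain q r where q: "q \<in> Y" and r: "strict_mono r"
        and lim: "limitin mtopology ((\<lambda>k. y (i k)) \<circ> r) q sequentially"
      using Y unfolding compactin_sequentially by metis
    have "\<exists>i. d p (x i) < \<delta> \<and> d q (y i) < \<delta>" if "0 < \<delta>" for \<delta>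
    proof -
      have "(\<lambda>k. d (y (i (r k))) q) \<longlonglongrightarrow> 0"
        using lim by (simp add: limitin_metric_dist_null comp_def)
      then have "\<forall>\<^sub>F k in sequentially. d (y (i (r k))) q < \<delta>"
        using that by (rule order_tendstoD)
      moreover have "(\<lambda>k. (1/2::real) ^ r k) \<longlonglongrightarrow> 0"
        using LIMSEQ_subseq_LIMSEQ[OF LIMSEQ_realpow_zero[of "1/2::real"] r] by (simp add: comp_def)
      then have "\<forall>\<^sub>F k in sequentially. (1/2) ^ r k < \<delta>"
        using that by (rule order_tendstoD)
      ultimately have "\<forall>\<^sub>F k in sequentially. d p (x (i (r k))) < \<delta> \<and> d q (y (i (r k))) < \<delta>"
        by eventually_elim (use i in \<open>auto simp: commute intro: less_trans\<close>)
      then show ?thesis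
        by (auto simp: eventually_sequentially)
    qed
    with p q show ?thesis
      unfolding R_def by blast
  qed
  define \<phi> where "\<phi> p = (SOME q. R p q)" for p
  have \<phi>: "R p (\<phi> p)" if "p \<in> X" for p
    unfolding \<phi>_def using total[OF that] by (rule someI_ex)
  have inj: "inj_on \<phi> X"
    using \<phi> inj_R by (metis inj_onI)
  show thesis
  proof
    show EY: "\<phi> ` X \<subseteq> Y"
      using \<phi> by (auto simp: R_def)
    show "\<exists>i. d e (y i) < \<delta>" if "e \<in> \<phi> ` X" "0 < \<delta>" for e \<delta>
      using that \<phi> by (fastforce simp: R_def)
    have "homeomorphic_maps (subtopology mtopology X) (subtopology mtopology (\<phi> ` X)) \<phi> (inv_into X \<phi>)"
      unfolding homeomorphic_maps_def
    proof (intro conjI ballI)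
      show "continuous_map (subtopology mtopology X) (subtopology mtopology (\<phi> ` X)) \<phi>"
      proof (rule continuous_map_subtopologyI)
        fix \<epsilon> :: real assume "0 < \<epsilon>"
        then obtain \<delta> where "0 < \<delta>" "\<And>p p' q q'. R p q \<Longrightarrow> R p' q' \<Longrightarrow> d p p' < \<delta> \<Longrightarrow> d q q' < \<epsilon>"
          using RXY by metis
        then show "\<exists>\<delta>>0. \<forall>p\<in>X. \<forall>q\<in>X. d p q < \<delta> \<longrightarrow> d (\<phi> p) (\<phi> q) < \<epsilon>"
          using \<phi> by blast
      qed (use X EY YM in auto)
      show "continuous_map (subtopology mtopology (\<phi> ` X)) (subtopology mtopology X) (inv_into X \<phi>)"
      proof (rule continuous_map_subtopologyI)
        fix \<epsilon> :: real assume "0 < \<epsilon>"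
        then obtain \<delta> where \<delta>: "0 < \<delta>" "\<And>p p' q q'. R p q \<Longrightarrow> R p' q' \<Longrightarrow> d q q' < \<delta> \<Longrightarrow> d p p' < \<epsilon>"
          using RYX by metis
        have "d (inv_into X \<phi> (\<phi> p)) (inv_into X \<phi> (\<phi> q)) < \<epsilon>" if "p \<in> X" "q \<in> X" "d (\<phi> p) (\<phi> q) < \<delta>" for p q
          using \<delta>(2)[OF \<phi>[OF that(1)] \<phi>[OF that(2)] that(3)] that inj by simp
        with \<delta>(1) show "\<exists>\<delta>>0. \<forall>p\<in>\<phi> ` X. \<forall>q\<in>\<phi> ` X. d p q < \<delta> \<longrightarrow> d (inv_into X \<phi> p) (inv_into X \<phi> q) < \<epsilon>"
          by blast
      qed (use X EY YM inj in auto)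
    qed (use inj in auto)
    then show "subtopology mtopology (\<phi> ` X) homeomorphic_space subtopology mtopology X"
      using homeomorphic_space_sym unfolding homeomorphic_space_def by blast
  qed
qed

end

section \<open>Rational balls\<close>

lemma ball_encode_eq: "ball_encode = encode"
  by (auto simp: ball_encode_def encode_prod_def encode_list_def encode_rat_def fun_eq_iff)

lemma ball_list_encode_eq: "ball_list_encode = encode"
  by (simp add: ball_list_encode_def encode_list_def ball_encode_eq fun_eq_iff)

text \<open>\<open>drop\<close> and \<open>case\<close> are chosen because both preserve
  \<open>computable\<close>; the empty tail supplies the value 0 that \<open>ball_center\<close> has
  beyond the list.\<close>

definition coord :: "rat list \<Rightarrow> nat \<Rightarrow> rat" where
  "coord cs i = (case drop i cs of [] \<Rightarrow> 0 | c # _ \<Rightarrow> c)"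

text \<open>Both centers vanish from index \<open>length cs + length ds\<close> on, so this finite
  sum is the exact value of \<open>dist_Q\<close> between them, and it is rational.\<close>

definition rat_dist :: "rat list \<Rightarrow> rat list \<Rightarrow> rat" where
  "rat_dist cs ds = (\<Sum>i<length cs + length ds. (1/2) ^ i * \<bar>coord cs i - coord ds i\<bar>)"

lemma coord_eq: "coord cs i = (if i < length cs then cs ! i else 0)"
  by (simp add: coord_def Cons_nth_drop_Suc[symmetric])

lemma computable_rat_dist [computable_intros]:
  assumes "computable f" "computable g"
  shows "computable (\<lambda>x. rat_dist (f x) (g x))"
  unfolding rat_dist_def coord_def
  by (intro computable_intros assms computable_comp[OF assms(1)] computable_comp[OF assms(2)])

lemma dist_ball_center:
  "dist_Q (ball_center b) (ball_center c) = of_rat (rat_dist (fst b) (fst c))"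
proof -
  let ?h = "\<lambda>i. (1/2) ^ i * \<bar>ball_center b i - ball_center c i\<bar>"
  have "dist_Q (ball_center b) (ball_center c) = infsum ?h {..<length (fst b) + length (fst c)}"
    unfolding dist_Q_def by (rule infsum_cong_neutral) (auto simp: ball_center_def)
  also have "\<dots> = (\<Sum>i<length (fst b) + length (fst c). ?h i)"
    by simp
  also have "\<dots> = of_rat (rat_dist (fst b) (fst c))"
    unfolding rat_dist_def of_rat_sum
  proof (intro sum.cong refl)
    have center: "ball_center b i = of_rat (coord (fst b) i)" for b i
      by (simp add: ball_center_def coord_eq)
    show "?h i = of_rat ((1/2) ^ i * \<bar>coord (fst b) i - coord (fst c) i\<bar>)" for i
      unfolding center of_rat_diff[symmetric] abs_of_rat by (simp add: of_rat_mult of_rat_power of_rat_divide)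
  qed
  finally show ?thesis .
qed

lemma ball_center_in_cube: "b \<in> rational_balls \<Longrightarrow> ball_center b \<in> hilbert_cube"
  by (auto simp: rational_balls_def hilbert_cube_def ball_center_def dest!: nth_mem)

lemma dist_less_radius:
  "x \<in> ball_set b \<Longrightarrow> x \<in> hilbert_cube \<and> dist_Q (ball_center b) x < of_rat (snd b)"
  by (auto simp: ball_set_def)

text \<open>With its companion below, this transfers rational data about centers to arbitrary points
  of the balls: here a lower bound on the distance of the points, there an upper bound.\<close>

lemma rat_dist_le:
  assumes "b \<in> rational_balls" "c \<in> rational_balls" "x \<in> ball_set b" "y \<in> ball_set c"
  shows "of_rat (rat_dist (fst b) (fst c)) \<le> dist_Q x y + of_rat (snd b) + of_rat (snd c)"
proof -
  note b = ball_center_in_cube[OF assms(1)] dist_less_radius[OF assms(3)]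
  note c = ball_center_in_cube[OF assms(2)] dist_less_radius[OF assms(4)]
  show ?thesis
    using Q.triangle[of "ball_center b" x "ball_center c"] Q.triangle[of x y "ball_center c"] b c
      Q.commute[of y "ball_center c"]
    unfolding dist_ball_center[symmetric] by linarith
qed

lemma dist_le_rat_dist:
  assumes "b \<in> rational_balls" "c \<in> rational_balls" "x \<in> ball_set b" "y \<in> ball_set c"
  shows "dist_Q x y < of_rat (rat_dist (fst b) (fst c) + snd b + snd c)"
proof -
  note b = ball_center_in_cube[OF assms(1)] dist_less_radius[OF assms(3)]
  note c = ball_center_in_cube[OF assms(2)] dist_less_radius[OF assms(4)]
  show ?thesis
    using Q.triangle[of x "ball_center b" y] Q.triangle[of "ball_center b" "ball_center c" y] b c
      Q.commute[of x "ball_center b"]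
    unfolding of_rat_add dist_ball_center[symmetric] by linarith
qed

section \<open>Approximation by small rational balls\<close>

lemma small_rational_ball:
  assumes x: "x \<in> hilbert_cube"
  obtains b where "b \<in> rational_balls" "x \<in> ball_set b" "snd b = (1/2) ^ k"
proof -
  \<comment> \<open>The rounding errors of the coordinates weigh at most
    \<open>2 * \<epsilon> = (1/2) ^ (k + 2)\<close> and the dropped tail at most
    \<open>2 * (1/2) ^ m = (1/2) ^ (k + 1)\<close>, together three quarters of the radius.\<close>
  define m where "m = k + 2"
  define \<epsilon> :: real where "\<epsilon> = (1/2) ^ (k + 3)"
  have "0 < \<epsilon>"
    by (simp add: \<epsilon>_def)
  have x01: "0 \<le> x i" "x i \<le> 1" for i
    using x by (auto simp: hilbert_cube_def)
  have "\<exists>q. 0 \<le> q \<and> q \<le> 1 \<and> \<bar>x i - of_rat q\<bar> \<le> \<epsilon>" for i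
  proof -
    \<comment> \<open>Clamping the interval to the unit interval before using density makes the
      rational a legal coordinate.\<close>
    have "max 0 (x i - \<epsilon>) < min 1 (x i + \<epsilon>)"
      using x01[of i] \<open>0 < \<epsilon>\<close> by auto
    then obtain q where q: "max 0 (x i - \<epsilon>) < of_rat q" "of_rat q < min 1 (x i + \<epsilon>)"
      using of_rat_dense by blast
    then have "0 < q" "q < 1"
      by (simp_all add: zero_less_of_rat_iff of_rat_less_1_iff)
    with q show ?thesis
      by (intro exI[of _ q]) auto
  qed
  then obtain q where q: "\<And>i. 0 \<le> q i" "\<And>i. q i \<le> 1" "\<And>i. \<bar>x i - of_rat (q i)\<bar> \<le> \<epsilon>"
    by metis
  define b :: rational_ball where "b = (map q [0..<m], (1/2) ^ k)"
  have b: "b \<in> rational_balls"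
    using q by (auto simp: b_def rational_balls_def)
  define B where "B i = (1/2) ^ i * \<epsilon> + (if i < m then 0 else (1/2::real) ^ i)" for i
  have "(\<lambda>i. (1/2) ^ (i + m)) sums ((1/2::real) ^ m * 2)"
    using sums_mult[OF geometric_sums[of "1/2::real"], of "(1/2) ^ m"] by (simp add: power_add mult.commute)
  then have "(\<lambda>i. if i + m < m then 0 else (1/2) ^ (i + m)) sums ((1/2::real) ^ m * 2)"
    by simp
  then have "(\<lambda>i. if i < m then 0 else (1/2) ^ i) sums ((1/2::real) ^ m * 2)"
    by (subst (asm) sums_zero_iff_shift) simp_all
  then have B: "B sums (2 * \<epsilon> + (1/2) ^ m * 2)"
    unfolding B_def using geometric_sums[of "1/2::real"] by (intro sums_add sums_mult2) simp_all
  have "dist_Q (ball_center b) x = (\<Sum>i. (1/2) ^ i * \<bar>ball_center b i - x i\<bar>)"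
    by (rule dist_Q_eq_suminf[OF ball_center_in_cube[OF b] x])
  also have "\<dots> \<le> suminf B"
  proof (rule suminf_le)
    show "summable (\<lambda>i. (1/2) ^ i * \<bar>ball_center b i - x i\<bar>)"
      using dist_Q_summable[OF ball_center_in_cube[OF b] x] by (rule summable_on_UNIV_nonneg_real_iff[THEN iffD1, rotated]) simp
    show "summable B"
      using B by (rule sums_summable)
    show "(1/2) ^ i * \<bar>ball_center b i - x i\<bar> \<le> B i" for i
    proof (cases "i < m")
      case True
      then show ?thesis
        using q(3)[of i] by (simp add: b_def ball_center_def B_def abs_minus_commute)
    next
      case False
      then have "(1/2) ^ i * \<bar>ball_center b i - x i\<bar> \<le> (1/2) ^ i"
        using x01[of i] by (simp add: b_def ball_center_def)
      then show ?thesis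
        using False by (simp add: B_def \<epsilon>_def add_increasing)
    qed
  qed
  also have "\<dots> = 2 * \<epsilon> + (1/2) ^ m * 2"
    using B by (rule sums_unique[symmetric])
  also have "\<dots> < (1/2) ^ k"
    by (simp add: \<epsilon>_def m_def power_add field_simps)
  finally have "x \<in> ball_set b"
    using x ball_center_in_cube[OF b] by (simp add: ball_set_def b_def of_rat_power of_rat_divide)
  with b show thesis
    by (rule that) (simp add: b_def)
qed

text \<open>Keeping only balls that meet \<open>Y\<close> places every center within
  \<open>(1/2) ^ k\<close> of a point of \<open>Y\<close>, so that sequences of chosen balls can be
  controlled by compactness of \<open>Y\<close>.\<close>

lemma small_rational_cover:
  assumes Y: "compactin Q.mtopology Y"
  obtains C where "set C \<subseteq> rational_balls" "Y \<subseteq> (\<Union>c\<in>set C. ball_set c)"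
    "\<And>c. c \<in> set C \<Longrightarrow> snd c = (1/2) ^ k \<and> ball_set c \<inter> Y \<noteq> {}"
proof -
  let ?S = "{b \<in> rational_balls. snd b = (1/2) ^ k \<and> ball_set b \<inter> Y \<noteq> {}}"
  have "Y \<subseteq> hilbert_cube"
    using Y by (simp add: Q.compactin_sequentially)
  have "Y \<subseteq> \<Union> (ball_set ` ?S)"
  proof
    fix y assume "y \<in> Y"
    obtain b where "b \<in> rational_balls" "y \<in> ball_set b" "snd b = (1/2) ^ k"
      using small_rational_ball \<open>y \<in> Y\<close> \<open>Y \<subseteq> hilbert_cube\<close> by blast
    then show "y \<in> \<Union> (ball_set ` ?S)"
      using \<open>y \<in> Y\<close> by blast
  qed
  moreover have "openin Q.mtopology U" if "U \<in> ball_set ` ?S" for U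
    using that Q.openin_mball unfolding ball_set_def by blast
  ultimately obtain \<F> where F: "finite \<F>" "\<F> \<subseteq> ball_set ` ?S" "Y \<subseteq> \<Union> \<F>"
    using compactinD[OF Y] by meson
  obtain T where T: "T \<subseteq> ?S" "finite T" "\<F> = ball_set ` T"
    using finite_subset_image[OF F(1,2)] by blast
  obtain C where C: "set C = T"
    using finite_list[OF T(2)] by blast
  show thesis
    by (rule that[of C]) (use T F(3) C in auto)
qed


section \<open>Certificates\<close>

text \<open>The radii are added so that the verdict holds for all points at once: any two points of
  \<open>b\<close> and \<open>b'\<close> are closer than \<open>(1/2) ^ \<mu> n\<close>, while any
  two of \<open>c\<close> and \<open>c'\<close> are further apart than \<open>(1/2) ^ n\<close>.
  Only rational comparisons occur.\<close>

definition incompatible ::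
  "(nat \<Rightarrow> nat) \<Rightarrow> nat \<Rightarrow> rational_ball \<Rightarrow> rational_ball \<Rightarrow> rational_ball \<Rightarrow> rational_ball \<Rightarrow> bool" where
  "incompatible \<mu> n b b' c c' \<longleftrightarrow>
     rat_dist (fst b) (fst b') + snd b + snd b' < (1/2) ^ \<mu> n \<and>
     (1/2) ^ n + snd c + snd c' < rat_dist (fst c) (fst c')"

text \<open>An assignment is a list of pairs, one for each position of \<open>bs\<close>, so all
  assignments form a finite product that can be searched. The first alternative forces the target
  ball into \<open>B\<close>; \<open>N\<close> bounds the precisions tested and thereby keeps the
  condition decidable.\<close>

definition refuted ::
  "(nat \<Rightarrow> nat) \<Rightarrow> (nat \<Rightarrow> nat) \<Rightarrow> rational_ball \<Rightarrow> rational_ball list \<Rightarrow> rational_ball list \<Rightarrow> nat \<Rightarrow> bool" where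
  "refuted \<mu> \<nu> B bs cs N \<longleftrightarrow> (\<forall>ps\<in>set (product_lists (map (\<lambda>b. map (\<lambda>c. (b, c)) cs) bs)).
     (\<exists>p\<in>set ps. rat_dist (fst (snd p)) (fst B) + snd (snd p) \<le> snd B) \<or>
     (\<exists>p\<in>set ps. \<exists>p'\<in>set ps. \<exists>n<N. incompatible \<mu> n (fst p) (fst p') (snd p) (snd p') \<or>
        incompatible \<nu> n (snd p) (snd p') (fst p) (fst p')))"

lemma computable_refuted:
  assumes "computable \<mu>" "computable \<nu>" and "computable B" "computable bs" "computable cs" "computable N"
  shows "computable (\<lambda>x. refuted \<mu> \<nu> (B x) (bs x) (cs x) (N x))"
  unfolding refuted_def incompatible_def
  by (intro computable_intros computable_comp[OF assms(1)] computable_comp[OF assms(2)] assms(3-6)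
      computable_comp[OF assms(3)] computable_comp[OF assms(4)] computable_comp[OF assms(5)] computable_comp[OF assms(6)])

lemma not_incompatible:
  assumes "b \<in> rational_balls" "b' \<in> rational_balls" "c \<in> rational_balls" "c' \<in> rational_balls"
    and "x \<in> ball_set b" "x' \<in> ball_set b'" "y \<in> ball_set c" "y' \<in> ball_set c'"
    and mod: "dist_Q x x' < (1/2) ^ \<mu> n \<Longrightarrow> dist_Q y y' \<le> (1/2) ^ n"
  shows "\<not> incompatible \<mu> n b b' c c'"
proof
  assume "incompatible \<mu> n b b' c c'"
  then have i: "rat_dist (fst b) (fst b') + snd b + snd b' < (1/2) ^ \<mu> n"
      "(1/2) ^ n + snd c + snd c' < rat_dist (fst c) (fst c')"
    by (auto simp: incompatible_def)
  have "dist_Q x x' < of_rat (rat_dist (fst b) (fst b') + snd b + snd b')"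
    by (rule dist_le_rat_dist) (use assms in auto)
  also have "\<dots> < of_rat ((1/2) ^ \<mu> n)"
    using i(1) by (simp only: of_rat_less)
  finally have "dist_Q y y' \<le> (1/2) ^ n"
    by (intro mod) (simp add: of_rat_power of_rat_divide)
  moreover have "of_rat (rat_dist (fst c) (fst c')) \<le> dist_Q y y' + of_rat (snd c) + of_rat (snd c')"
    by (rule rat_dist_le) (use assms in auto)
  moreover have "of_rat ((1/2) ^ n + snd c + snd c') < (of_rat (rat_dist (fst c) (fst c')) :: real)"
    using i(2) by (simp only: of_rat_less)
  ultimately show False
    by (simp add: of_rat_power of_rat_divide of_rat_add)
qed

text \<open>Soundness: if \<open>B\<close> missed \<open>Y\<close>, then \<open>f\<close> itself
  would give an assignment. Points of \<open>X\<close> in the balls of \<open>bs\<close> and cover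
  balls around their images respect both moduli, and no such cover ball lies inside
  \<open>B\<close>, since it contains a point of \<open>Y\<close>.\<close>

lemma refuted_imp_meets:
  assumes X: "X \<subseteq> hilbert_cube" and f: "f ` X \<subseteq> Y" and gf: "\<And>x. x \<in> X \<Longrightarrow> g (f x) = x"
    and \<mu>: "uniform_modulus \<mu> X f" and \<nu>: "uniform_modulus \<nu> Y g"
    and B: "B \<in> rational_balls"
    and bs: "set bs \<subseteq> {b \<in> rational_balls. ball_set b \<inter> X \<noteq> {}}"
    and cs: "set cs \<subseteq> rational_balls" "Y \<subseteq> (\<Union>c\<in>set cs. ball_set c)"
    and ref: "refuted \<mu> \<nu> B bs cs N"
  shows "ball_set B \<inter> Y \<noteq> {}"
proof
  assume disj: "ball_set B \<inter> Y = {}"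
  have "\<forall>b\<in>set bs. \<exists>x. x \<in> ball_set b \<inter> X"
    using bs by blast
  then obtain x where x: "\<And>b. b \<in> set bs \<Longrightarrow> x b \<in> ball_set b \<inter> X"
    by metis
  have "\<forall>b\<in>set bs. \<exists>c. c \<in> set cs \<and> f (x b) \<in> ball_set c"
    using x f cs(2) by blast
  then obtain c where c: "\<And>b. b \<in> set bs \<Longrightarrow> c b \<in> set cs \<and> f (x b) \<in> ball_set (c b)"
    by metis
  have xb: "b \<in> rational_balls \<and> x b \<in> ball_set b" and cb: "c b \<in> rational_balls \<and> f (x b) \<in> ball_set (c b)"
    if "b \<in> set bs" for b
    using x[OF that] c[OF that] bs cs(1) that by blast+
  have mem: "map (\<lambda>b. (b, c b)) bs \<in> set (product_lists (map (\<lambda>b. map (\<lambda>c. (b, c)) cs) bs))"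
    using c by (auto simp: product_lists_set list_all2_conv_all_nth)
  have "(\<exists>b\<in>set bs. rat_dist (fst (c b)) (fst B) + snd (c b) \<le> snd B) \<or>
      (\<exists>b\<in>set bs. \<exists>b'\<in>set bs. \<exists>n. incompatible \<mu> n b b' (c b) (c b') \<or> incompatible \<nu> n (c b) (c b') b b')"
    using bspec[OF ref[unfolded refuted_def] mem] by simp blast
  then show False
  proof (elim disjE bexE exE)
    fix b assume b: "b \<in> set bs" and le: "rat_dist (fst (c b)) (fst B) + snd (c b) \<le> snd B"
    have cb: "c b \<in> rational_balls" "f (x b) \<in> ball_set (c b)"
      using c[OF b] cs(1) by auto
    have "of_rat (rat_dist (fst (c b)) (fst B)) + of_rat (snd (c b)) \<le> (of_rat (snd B) :: real)"
      using le by (simp only: of_rat_add[symmetric] of_rat_less_eq)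
    then have "dist_Q (ball_center B) (f (x b)) < of_rat (snd B)"
      using Q.triangle[of "ball_center B" "ball_center (c b)" "f (x b)"] dist_less_radius[OF cb(2)]
        ball_center_in_cube[OF B] ball_center_in_cube[OF cb(1)] Q.commute[of "ball_center B" "ball_center (c b)"]
      unfolding dist_ball_center[symmetric] by linarith
    then have "f (x b) \<in> ball_set B"
      using ball_center_in_cube[OF B] dist_less_radius[OF cb(2)] by (simp add: ball_set_def)
    then show False
      using disj f x[OF b] by blast
  next
    fix b b' n assume b: "b \<in> set bs" "b' \<in> set bs" and inc: "incompatible \<mu> n b b' (c b) (c b')"
    have "dist_Q (f (x b)) (f (x b')) \<le> (1/2) ^ n" if "dist_Q (x b) (x b') < (1/2) ^ \<mu> n"
      using that \<mu> x[OF b(1)] x[OF b(2)] unfolding uniform_modulus_def by blast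
    then have "\<not> incompatible \<mu> n b b' (c b) (c b')"
      by (intro not_incompatible[of b b' "c b" "c b'" "x b" "x b'" "f (x b)" "f (x b')"])
        (simp_all add: b xb cb)
    with inc show False by blast
  next
    fix b b' n assume b: "b \<in> set bs" "b' \<in> set bs" and inc: "incompatible \<nu> n (c b) (c b') b b'"
    have "dist_Q (x b) (x b') \<le> (1/2) ^ n" if "dist_Q (f (x b)) (f (x b')) < (1/2) ^ \<nu> n"
      using that \<nu> x[OF b(1)] x[OF b(2)] f gf unfolding uniform_modulus_def
      by (metis IntD2 image_subset_iff)
    then have "\<not> incompatible \<nu> n (c b) (c b') b b'"
      by (intro not_incompatible[of "c b" "c b'" b b' "f (x b)" "f (x b')" "x b" "x b'"])
        (simp_all add: b xb cb)
    with inc show False by blast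
  qed
qed

section \<open>Limits of assignments that escape refutation\<close>

lemma (in Metric_space) tendsto_dist:
  assumes M: "\<And>k. u k \<in> M" "\<And>k. v k \<in> M" "p \<in> M" "q \<in> M"
    and u: "(\<lambda>k. d (u k) p) \<longlonglongrightarrow> 0" and v: "(\<lambda>k. d (v k) q) \<longlonglongrightarrow> 0"
  shows "(\<lambda>k. d (u k) (v k)) \<longlonglongrightarrow> d p q"
proof (rule LIM_zero_cancel, rule Lim_null_comparison)
  show "(\<lambda>k. d (u k) p + d (v k) q) \<longlonglongrightarrow> 0"
    using tendsto_add[OF u v] by simp
  have "\<bar>d (u k) (v k) - d p q\<bar> \<le> d (u k) p + d (v k) q" for k
    using triangle[OF M(1)[of k] M(3) M(2)[of k]] triangle[OF M(3,4) M(2)[of k]]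
      triangle[OF M(3) M(1)[of k] M(4)] triangle[OF M(1)[of k] M(2)[of k] M(4)]
      commute[of p "u k"] commute[of q "v k"]
    by linarith
  then show "\<forall>\<^sub>F k in sequentially. norm (d (u k) (v k) - d p q) \<le> d (u k) p + d (v k) q"
    by simp
qed

text \<open>If the limits satisfy the strict premise, then eventually so do the centers with the
  radii added. Compatibility makes the second half of \<open>incompatible\<close> fail there, and
  the resulting weak bound passes to the limit as the radii vanish.\<close>

lemma limit_modulus:
  assumes balls: "\<And>k. b k \<in> rational_balls" "\<And>k. b' k \<in> rational_balls"
      "\<And>k. c k \<in> rational_balls" "\<And>k. c' k \<in> rational_balls"
    and radii: "(\<lambda>k. real_of_rat (snd (b k))) \<longlonglongrightarrow> 0" "(\<lambda>k. real_of_rat (snd (b' k))) \<longlonglongrightarrow> 0"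
      "(\<lambda>k. real_of_rat (snd (c k))) \<longlonglongrightarrow> 0" "(\<lambda>k. real_of_rat (snd (c' k))) \<longlonglongrightarrow> 0"
    and cube: "p \<in> hilbert_cube" "p' \<in> hilbert_cube" "q \<in> hilbert_cube" "q' \<in> hilbert_cube"
    and lim: "(\<lambda>k. dist_Q (ball_center (b k)) p) \<longlonglongrightarrow> 0" "(\<lambda>k. dist_Q (ball_center (b' k)) p') \<longlonglongrightarrow> 0"
      "(\<lambda>k. dist_Q (ball_center (c k)) q) \<longlonglongrightarrow> 0" "(\<lambda>k. dist_Q (ball_center (c' k)) q') \<longlonglongrightarrow> 0"
    and compat: "\<forall>\<^sub>F k in sequentially. \<not> incompatible \<mu> n (b k) (b' k) (c k) (c' k)"
    and less: "dist_Q p p' < (1/2) ^ \<mu> n"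
  shows "dist_Q q q' \<le> (1/2) ^ n"
proof (rule tendsto_le[OF sequentially_bot])
  note cen = ball_center_in_cube[OF balls(1)] ball_center_in_cube[OF balls(2)]
    ball_center_in_cube[OF balls(3)] ball_center_in_cube[OF balls(4)]
  show "(\<lambda>k. dist_Q (ball_center (c k)) (ball_center (c' k))) \<longlonglongrightarrow> dist_Q q q'"
    by (rule Q.tendsto_dist[OF cen(3,4) cube(3,4) lim(3,4)])
  show "(\<lambda>k. (1/2) ^ n + real_of_rat (snd (c k)) + real_of_rat (snd (c' k))) \<longlonglongrightarrow> (1/2) ^ n"
    using tendsto_add[OF tendsto_add[OF tendsto_const[of "(1/2::real) ^ n"] radii(3)] radii(4)] by simp
  have "(\<lambda>k. dist_Q (ball_center (b k)) (ball_center (b' k)) + real_of_rat (snd (b k)) + real_of_rat (snd (b' k)))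
      \<longlonglongrightarrow> dist_Q p p'"
    using tendsto_add[OF tendsto_add[OF Q.tendsto_dist[OF cen(1,2) cube(1,2) lim(1,2)] radii(1)] radii(2)]
    by simp
  then have "\<forall>\<^sub>F k in sequentially. dist_Q (ball_center (b k)) (ball_center (b' k)) + real_of_rat (snd (b k))
      + real_of_rat (snd (b' k)) < (1/2) ^ \<mu> n"
    using less by (rule order_tendstoD)
  with compat show "\<forall>\<^sub>F k in sequentially. dist_Q (ball_center (c k)) (ball_center (c' k))
      \<le> (1/2) ^ n + real_of_rat (snd (c k)) + real_of_rat (snd (c' k))"
  proof eventually_elim
    case (elim k)
    have half: "(1/2) ^ m = real_of_rat ((1/2) ^ m)" for m
      by (simp add: of_rat_power of_rat_divide)
    show ?case
      using elim unfolding incompatible_def dist_ball_center half of_rat_add[symmetric] of_rat_less of_rat_less_eq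
      by linarith
  qed
qed

text \<open>Completeness, by contradiction: escaping assignments for ever finer data converge to an
  embedding of \<open>X\<close> into \<open>Y\<close> that avoids \<open>B\<close>. Carried back by
  \<open>g\<close>, its image is a proper subset of \<open>X\<close> homeomorphic to
  \<open>X\<close>.\<close>

lemma refuted_if_meets:
  assumes X: "compactin Q.mtopology X" "X \<noteq> {}" and Y: "compactin Q.mtopology Y"
    and fg: "homeomorphic_maps (subspace_Q X) (subspace_Q Y) f g"
    and min: "\<not> (\<exists>Z. Z \<subset> X \<and> subspace_Q Z homeomorphic_space subspace_Q X)"
    and B: "B \<in> rational_balls" "ball_set B \<inter> Y \<noteq> {}"
  obtains bs cs N where "set bs \<subseteq> {b \<in> rational_balls. ball_set b \<inter> X \<noteq> {}}"
    "set cs \<subseteq> rational_balls" "Y \<subseteq> (\<Union>c\<in>set cs. ball_set c)" "refuted \<mu> \<nu> B bs cs N"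
proof (rule ccontr)
  note that' = that
  assume "\<not> thesis"
  then have nref: "\<not> refuted \<mu> \<nu> B bs cs N"
    if "set bs \<subseteq> {b \<in> rational_balls. ball_set b \<inter> X \<noteq> {}}" "set cs \<subseteq> rational_balls"
      "Y \<subseteq> (\<Union>c\<in>set cs. ball_set c)" for bs cs N
    using that'[OF that] by blast
  have sub: "X \<subseteq> hilbert_cube" "Y \<subseteq> hilbert_cube"
    using X(1) Y by (simp_all add: Q.compactin_sequentially)
  obtain x :: "nat \<Rightarrow> nat \<Rightarrow> real" where x: "range x \<subseteq> X" "\<And>p \<delta>. p \<in> X \<Longrightarrow> 0 < \<delta> \<Longrightarrow> \<exists>i. dist_Q p (x i) < \<delta>"
    by (rule Q.compactin_dense_sequence[OF X], rule that)
  have xX: "x i \<in> X" for i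
    using x(1) by blast
  have "\<exists>b. b \<in> rational_balls \<and> x i \<in> ball_set b \<and> snd b = (1/2) ^ k" for i k
    using small_rational_ball[of "x i"] xX sub(1) by (metis subsetD)
  then obtain b where b: "\<And>i k. b i k \<in> rational_balls" "\<And>i k. x i \<in> ball_set (b i k)"
      "\<And>i k. snd (b i k) = (1/2) ^ k"
    by metis
  have "\<exists>C. set C \<subseteq> rational_balls \<and> Y \<subseteq> (\<Union>c\<in>set C. ball_set c)
      \<and> (\<forall>c\<in>set C. snd c = (1/2) ^ k \<and> ball_set c \<inter> Y \<noteq> {})" for k
    using small_rational_cover[OF Y] by metis
  then obtain C where C: "\<And>k. set (C k) \<subseteq> rational_balls" "\<And>k. Y \<subseteq> (\<Union>c\<in>set (C k). ball_set c)"
      "\<And>k c. c \<in> set (C k) \<Longrightarrow> snd c = (1/2) ^ k \<and> ball_set c \<inter> Y \<noteq> {}"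
    by metis
  \<comment> \<open>Stage \<open>k\<close> treats the first \<open>k + 1\<close> points, balls of
    radius \<open>(1/2) ^ k\<close> on both sides, and precisions below \<open>k\<close>. Every
    single constraint is thus imposed at all but finitely many stages.\<close>
  have "\<exists>c. \<forall>i. c i \<in> set (C k) \<and>
      (i \<le> k \<longrightarrow> snd B < rat_dist (fst (c i)) (fst B) + snd (c i)) \<and>
      (\<forall>j n. i \<le> k \<longrightarrow> j \<le> k \<longrightarrow> n < k \<longrightarrow> \<not> incompatible \<mu> n (b i k) (b j k) (c i) (c j) \<and>
         \<not> incompatible \<nu> n (c i) (c j) (b i k) (b j k))" for k
  proof -
    let ?bs = "map (\<lambda>i. b i k) [0..<Suc k]"
    have "\<not> refuted \<mu> \<nu> B ?bs (C k) k"
    proof (rule nref)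
      show "set ?bs \<subseteq> {b \<in> rational_balls. ball_set b \<inter> X \<noteq> {}}"
        unfolding set_map by (rule image_subsetI) (use b(1,2) xX in blast)
    qed (rule C)+
    then obtain ps where ps: "ps \<in> set (product_lists (map (\<lambda>b. map (\<lambda>c. (b, c)) (C k)) ?bs))"
        and in_ps: "\<And>p. p \<in> set ps \<Longrightarrow> \<not> rat_dist (fst (snd p)) (fst B) + snd (snd p) \<le> snd B"
          "\<And>p p' n. p \<in> set ps \<Longrightarrow> p' \<in> set ps \<Longrightarrow> n < k \<Longrightarrow>
            \<not> incompatible \<mu> n (fst p) (fst p') (snd p) (snd p') \<and>
            \<not> incompatible \<nu> n (snd p) (snd p') (fst p) (fst p')"
      unfolding refuted_def by blast
    have len: "length ps = Suc k"
      using in_set_product_lists_length[OF ps] by simp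
    have nth: "ps ! i \<in> set ps \<and> fst (ps ! i) = b i k \<and> snd (ps ! i) \<in> set (C k)" if "i \<le> k" for i
    proof -
      have "ps ! i \<in> set (map (\<lambda>c. (b i k, c)) (C k))"
        using ps that len unfolding product_lists_set list_all2_conv_all_nth
        by (auto simp del: upt_Suc simp: less_Suc_eq_le)
      then show ?thesis
        using that len by auto
    qed
    \<comment> \<open>Indices beyond \<open>k\<close> repeat the last ball through
      \<open>min i k\<close>. This filler stays in \<open>C k\<close>, so the choice becomes a full
      double sequence; constraints are claimed only for indices up to \<open>k\<close>.\<close>
    show ?thesis
    proof (intro exI[of _ "\<lambda>i. snd (ps ! min i k)"] allI conjI impI)
      fix i
      show "snd (ps ! min i k) \<in> set (C k)"
        using nth by simp
      assume i: "i \<le> k"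
      then show "snd B < rat_dist (fst (snd (ps ! min i k))) (fst B) + snd (snd (ps ! min i k))"
        using in_ps(1) nth by (simp add: not_le)
      fix j n assume j: "j \<le> k" and n: "n < k"
      show "\<not> incompatible \<mu> n (b i k) (b j k) (snd (ps ! min i k)) (snd (ps ! min j k))"
        "\<not> incompatible \<nu> n (snd (ps ! min i k)) (snd (ps ! min j k)) (b i k) (b j k)"
        using in_ps(2)[of "ps ! i" "ps ! j", OF _ _ n] nth[OF i] nth[OF j] i j by simp_all
    qed
  qed
  then obtain c where c: "\<And>i k. c k i \<in> set (C k)"
      "\<And>i k. i \<le> k \<Longrightarrow> snd B < rat_dist (fst (c k i)) (fst B) + snd (c k i)"
      "\<And>i j n k. i \<le> k \<Longrightarrow> j \<le> k \<Longrightarrow> n < k \<Longrightarrow> \<not> incompatible \<mu> n (b i k) (b j k) (c k i) (c k j)"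
      "\<And>i j n k. i \<le> k \<Longrightarrow> j \<le> k \<Longrightarrow> n < k \<Longrightarrow> \<not> incompatible \<nu> n (c k i) (c k j) (b i k) (b j k)"
    by metis
  have c_ball: "c k i \<in> rational_balls" "snd (c k i) = (1/2) ^ k" for k i
    using c(1)[of k i] C by auto
  \<comment> \<open>The centers of cover balls may lie outside \<open>Y\<close>. Points of
    \<open>Y\<close> in these balls stand in for them in the compactness argument, and the shrinking
    radii carry the limits over to the centers.\<close>
  have "\<exists>y. y \<in> ball_set (c k i) \<and> y \<in> Y" for i k
    using C(3)[OF c(1)] by blast
  from someI_ex[OF this] have "\<exists>y. \<forall>i k. y i k \<in> ball_set (c k i) \<and> y i k \<in> Y"
    by (intro exI[of _ "\<lambda>i k. SOME y. y \<in> ball_set (c k i) \<and> y \<in> Y"]) blast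
  then obtain y where y: "\<And>i k. y i k \<in> ball_set (c k i)" "\<And>i k. y i k \<in> Y"
    by blast
  obtain r l where r: "strict_mono r" and lY: "\<And>i. l i \<in> Y"
      and lim_y: "\<And>i. (\<lambda>k. dist_Q (y i (r k)) (l i)) \<longlonglongrightarrow> 0"
    by (rule Q.compactin_diagonal[OF Y, of y], rule y(2), rule that)
  have half: "(\<lambda>k. (1/2::real) ^ r k) \<longlonglongrightarrow> 0"
    using LIMSEQ_subseq_LIMSEQ[OF LIMSEQ_realpow_zero[of "1/2::real"] r] by (simp add: comp_def)
  then have radius: "(\<lambda>k. real_of_rat ((1/2) ^ r k)) \<longlonglongrightarrow> 0"
    by (simp add: of_rat_power of_rat_divide)
  have lim_b: "(\<lambda>k. dist_Q (ball_center (b i (r k))) (x i)) \<longlonglongrightarrow> 0" for i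
  proof (rule Lim_null_comparison[OF _ radius])
    show "\<forall>\<^sub>F k in sequentially. norm (dist_Q (ball_center (b i (r k))) (x i)) \<le> real_of_rat ((1/2) ^ r k)"
      using dist_less_radius[OF b(2)] by (intro always_eventually) (simp add: b(3) less_imp_le)
  qed
  have lim_c: "(\<lambda>k. dist_Q (ball_center (c (r k) i)) (l i)) \<longlonglongrightarrow> 0" for i
  proof (rule Lim_null_comparison)
    show "(\<lambda>k. real_of_rat ((1/2) ^ r k) + dist_Q (y i (r k)) (l i)) \<longlonglongrightarrow> 0"
      using tendsto_add[OF radius lim_y] by simp
    have "dist_Q (ball_center (c (r k) i)) (l i) \<le> real_of_rat ((1/2) ^ r k) + dist_Q (y i (r k)) (l i)" for k
      using Q.triangle[OF ball_center_in_cube[OF c_ball(1)], of "y i (r k)" "l i" "r k" i]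
        dist_less_radius[OF y(1)[of i "r k"]] lY[of i] sub(2) c_ball(2)[of "r k" i] by fastforce
    then show "\<forall>\<^sub>F k in sequentially. norm (dist_Q (ball_center (c (r k) i)) (l i))
        \<le> real_of_rat ((1/2) ^ r k) + dist_Q (y i (r k)) (l i)"
      by simp
  qed
  \<comment> \<open>A constraint on \<open>i\<close>, \<open>j\<close> and \<open>n\<close> is in
    force once the stage reaches \<open>i\<close>, \<open>j\<close> and \<open>Suc n\<close>; the
    last because stage \<open>k\<close> tests only \<open>n < k\<close>.\<close>
  have large: "\<forall>\<^sub>F k in sequentially. m \<le> r k" for m
    using filterlim_subseq[OF r] by (simp add: filterlim_at_top)
  have cube: "x i \<in> hilbert_cube" "l i \<in> hilbert_cube" for i
    using xX lY sub by auto
  have mod\<mu>: "dist_Q (l i) (l j) \<le> (1/2) ^ n" if "dist_Q (x i) (x j) < (1/2) ^ \<mu> n" for i j n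
  proof (rule limit_modulus[where b = "\<lambda>k. b i (r k)" and b' = "\<lambda>k. b j (r k)"
        and c = "\<lambda>k. c (r k) i" and c' = "\<lambda>k. c (r k) j", OF b(1) b(1) c_ball(1) c_ball(1)])
    show "\<forall>\<^sub>F k in sequentially. \<not> incompatible \<mu> n (b i (r k)) (b j (r k)) (c (r k) i) (c (r k) j)"
      using large[of i] large[of j] large[of "Suc n"] by eventually_elim (simp add: c(3))
  qed (use that radius lim_b lim_c cube in \<open>simp_all add: b(3) c_ball(2)\<close>)
  \<comment> \<open>Source and target balls trade places, since \<open>\<nu>\<close> controls the
    passage from \<open>Y\<close> back to \<open>X\<close>.\<close>
  have mod\<nu>: "dist_Q (x i) (x j) \<le> (1/2) ^ n" if "dist_Q (l i) (l j) < (1/2) ^ \<nu> n" for i j n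
  proof (rule limit_modulus[where c = "\<lambda>k. b i (r k)" and c' = "\<lambda>k. b j (r k)"
        and b = "\<lambda>k. c (r k) i" and b' = "\<lambda>k. c (r k) j", OF c_ball(1) c_ball(1) b(1) b(1)])
    show "\<forall>\<^sub>F k in sequentially. \<not> incompatible \<nu> n (c (r k) i) (c (r k) j) (b i (r k)) (b j (r k))"
      using large[of i] large[of j] large[of "Suc n"] by eventually_elim (simp add: c(4))
  qed (use that radius lim_b lim_c cube in \<open>simp_all add: b(3) c_ball(2)\<close>)
  \<comment> \<open>Cover balls that are not certified to lie inside \<open>B\<close> have centers
    at least \<open>snd B\<close> minus their radius away from its center. In the limit only a weak
    inequality is left, which is enough to stay out of an open ball.\<close>
  have far: "of_rat (snd B) \<le> dist_Q (l i) (ball_center B)" for i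
  proof (rule tendsto_le[OF sequentially_bot])
    note cube' = ball_center_in_cube[OF c_ball(1)] ball_center_in_cube[OF B(1)]
    have "(\<lambda>k. dist_Q (ball_center (c (r k) i)) (ball_center B)) \<longlonglongrightarrow> dist_Q (l i) (ball_center B)"
      by (rule Q.tendsto_dist) (use cube' cube lim_c in simp_all)
    from tendsto_add[OF this radius]
    show "(\<lambda>k. dist_Q (ball_center (c (r k) i)) (ball_center B) + real_of_rat (snd (c (r k) i)))
        \<longlonglongrightarrow> dist_Q (l i) (ball_center B)"
      by (simp add: c_ball(2))
    show "(\<lambda>k. real_of_rat (snd B)) \<longlonglongrightarrow> of_rat (snd B)"
      by simp
    show "\<forall>\<^sub>F k in sequentially. real_of_rat (snd B)
        \<le> dist_Q (ball_center (c (r k) i)) (ball_center B) + real_of_rat (snd (c (r k) i))"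
      using large[of i]
    proof eventually_elim
      case (elim k)
      from c(2)[OF this] show ?case
        unfolding dist_ball_center of_rat_add[symmetric] of_rat_less_eq by simp
    qed
  qed
  have eps: "\<exists>n. (1/2) ^ n < \<epsilon>" if "0 < \<epsilon>" for \<epsilon> :: real
    using that by (intro real_arch_pow_inv) simp_all
  obtain E where E: "E \<subseteq> Y" "\<And>e \<delta>. e \<in> E \<Longrightarrow> 0 < \<delta> \<Longrightarrow> \<exists>i. dist_Q e (l i) < \<delta>"
      "subspace_Q E homeomorphic_space subspace_Q X"
  proof (rule Q.dense_sequence_embedding[OF sub(1) Y x(1) _ x(2), of l])
    show "range l \<subseteq> Y"
      using lY by blast
    show "\<exists>\<delta>>0. \<forall>i j. dist_Q (x i) (x j) < \<delta> \<longrightarrow> dist_Q (l i) (l j) \<le> \<epsilon>" if pos: "0 < \<epsilon>" for \<epsilon>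
    proof -
      obtain n where n: "(1/2) ^ n < \<epsilon>"
        using eps[OF pos] by blast
      then show ?thesis
        using mod\<mu>[of _ _ n] by (intro exI[of _ "(1/2) ^ \<mu> n"]) (fastforce intro: order_trans less_imp_le)
    qed
    show "\<exists>\<delta>>0. \<forall>i j. dist_Q (l i) (l j) < \<delta> \<longrightarrow> dist_Q (x i) (x j) \<le> \<epsilon>" if pos: "0 < \<epsilon>" for \<epsilon>
    proof -
      obtain n where n: "(1/2) ^ n < \<epsilon>"
        using eps[OF pos] by blast
      then show ?thesis
        using mod\<nu>[of _ _ n] by (intro exI[of _ "(1/2) ^ \<nu> n"]) (fastforce intro: order_trans less_imp_le)
    qed
  qed (assumption+, rule that)
  obtain y0 where y0: "y0 \<in> ball_set B" "y0 \<in> Y"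
    using B(2) by blast
  have "y0 \<notin> E"
  proof
    assume "y0 \<in> E"
    \<comment> \<open>This is the room left around \<open>y0\<close> inside \<open>B\<close>: a term
      of \<open>l\<close> that close to \<open>y0\<close> would lie in \<open>B\<close>, against
      \<open>far\<close>.\<close>
    define \<delta> where "\<delta> = of_rat (snd B) - dist_Q (ball_center B) y0"
    have "0 < \<delta>"
      using dist_less_radius[OF y0(1)] by (simp add: \<delta>_def)
    then obtain i where i: "dist_Q y0 (l i) < \<delta>"
      using E(2)[OF \<open>y0 \<in> E\<close>] by blast
    have "dist_Q (ball_center B) (l i) \<le> dist_Q (ball_center B) y0 + dist_Q y0 (l i)"
      using ball_center_in_cube[OF B(1)] y0(2) sub(2) cube(2) by (intro Q.triangle) auto
    then show False
      using i far[of i] Q.commute[of "l i" "ball_center B"] by (simp add: \<delta>_def)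
  qed
  have top: "topspace (subspace_Q X) = X" "topspace (subspace_Q Y) = Y"
    using sub by auto
  have g: "g ` Y \<subseteq> X" and f: "\<And>y. y \<in> Y \<Longrightarrow> f (g y) = y"
    using fg top by (auto simp: homeomorphic_maps_def continuous_map_def)
  \<comment> \<open>Since \<open>f\<close> inverts \<open>g\<close> on \<open>Y\<close>, the point
    \<open>y0\<close> missed by \<open>E\<close> gives a point of \<open>X\<close> missed by the
    image of \<open>E\<close> under \<open>g\<close>.\<close>
  have "g y0 \<in> X" "g y0 \<notin> g ` E"
    using g f y0(2) \<open>y0 \<notin> E\<close> E(1) by (blast, metis imageE subsetD)
  then have "g ` E \<subset> X"
    using g E(1) by blast
  moreover have "homeomorphic_maps (subtopology (subspace_Q Y) E) (subtopology (subspace_Q X) (g ` E)) g f"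
  proof (rule homeomorphic_maps_subtopologies)
    show "homeomorphic_maps (subspace_Q Y) (subspace_Q X) g f"
      using fg by (rule homeomorphic_maps_sym[THEN iffD1])
    show "g ` (topspace (subspace_Q Y) \<inter> E) = topspace (subspace_Q X) \<inter> g ` E"
      using top E(1) g by auto
  qed
  then have "homeomorphic_maps (subspace_Q E) (subspace_Q (g ` E)) g f"
    using E(1) \<open>g ` E \<subset> X\<close> by (simp add: subtopology_subtopology Int_absorb1 psubset_imp_subset)
  then have "subspace_Q (g ` E) homeomorphic_space subspace_Q E"
    using homeomorphic_space_sym unfolding homeomorphic_space_def by blast
  then have "subspace_Q (g ` E) homeomorphic_space subspace_Q X"
    using E(3) by (rule homeomorphic_space_trans)
  ultimately show False
    using min by blast
qed


section \<open>Enumeration\<close>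

text \<open>A realizer of \<open>f\<close> is unconstrained at numbers that are not codes, so its
  range could be too large. A surjective coding of the domain rules this out, which is why
  certificates are later indexed by lists and tuples of naturals.\<close>

lemma ce_set_range:
  fixes f :: "'a::encodable \<Rightarrow> 'b::encodable"
  assumes "computable f" "surj (encode :: 'a \<Rightarrow> nat)"
  shows "ce_set (encode ` range f)"
proof -
  obtain F where F: "computable_fun F" "\<And>x. F (encode x) = encode (f x)"
    using assms(1) by (rule computableE) blast
  have "encode ` range f = range (\<lambda>x::'a. F (encode x))"
    by (simp add: F(2) image_image)
  also have "\<dots> = range F"
    using assms(2) by (metis image_image)
  finally show ?thesis
    using F(1) unfolding ce_set_def by blast
qed

text \<open>The encoding of naturals is the identity, so the function that enumerates the codes is
  itself a realizer of the decoded enumeration.\<close>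

lemma ce_set_enumeration:
  fixes S :: "'a::encodable set"
  assumes "ce_set (encode ` S)" "S \<noteq> {}"
  obtains e :: "nat \<Rightarrow> 'a" where "computable e" "range e = S"
proof -
  obtain F where F: "computable_fun F" "encode ` S = range F"
    using assms unfolding ce_set_def by auto
  have "\<exists>s. encode s = F n \<and> s \<in> S" for n
    using F(2) by (metis imageE rangeI)
  then obtain e where e: "\<And>n. encode (e n) = F n" "\<And>n. e n \<in> S"
    by metis
  have "s \<in> range e" if "s \<in> S" for s
  proof -
    have "encode s \<in> range F"
      using that unfolding F(2)[symmetric] by blast
    then obtain n where "encode s = encode (e n)"
      unfolding e(1) by blast
    then have "s = e n"
      by (rule injD[OF inj_encode])
    then show ?thesis by simp
  qed
  then have "range e = S"
    using e(2) by blast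
  moreover have "computable e"
    by (rule computableI[OF F(1)]) (simp add: e(1))
  ultimately show thesis
    by (rule that[rotated])
qed

lemma surj_encode_prod:
  assumes "surj (encode :: 'a::encodable \<Rightarrow> nat)" "surj (encode :: 'b::encodable \<Rightarrow> nat)"
  shows "surj (encode :: 'a \<times> 'b \<Rightarrow> nat)"
proof (rule surjI)
  fix n
  obtain a :: 'a and b :: 'b where "encode a = pfst n" "encode b = psnd n"
    using assms by (metis surjD)
  then show "encode ((inv encode (pfst n) :: 'a), (inv encode (psnd n) :: 'b)) = n"
    using assms by (simp add: surj_f_inv_f)
qed

lemma surj_encode_nat: "surj (encode :: nat \<Rightarrow> nat)"
  by (simp add: surj_def)

lemma surj_encode_nat_list: "surj (encode :: nat list \<Rightarrow> nat)"
proof -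
  have "(encode :: nat \<Rightarrow> nat) = id"
    by (simp add: fun_eq_iff)
  then have "(encode :: nat list \<Rightarrow> nat) = list_encode"
    by (intro ext) (simp add: encode_list_def)
  then show ?thesis
    by (simp add: surj_list_encode)
qed

theorem theorem5p11:
  fixes X Y :: "(nat \<Rightarrow> real) set"
  assumes "X \<subseteq> hilbert_cube" and "computable_compact X"
    and "\<not> (\<exists>Z. Z \<subset> X \<and> subspace_Q Z homeomorphic_space subspace_Q X)"
    and "Y \<subseteq> hilbert_cube" and "simple_copy Y X"
    and "semicomputable Y"
  shows "computable_compact Y"
proof -
  let ?BX = "{b \<in> rational_balls. ball_set b \<inter> X \<noteq> {}}"
  let ?BY = "{b \<in> rational_balls. ball_set b \<inter> Y \<noteq> {}}"
  let ?CY = "{cs \<in> lists rational_balls. Y \<subseteq> (\<Union>c\<in>set cs. ball_set c)}"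
  have X: "compactin Q.mtopology X" and ceX: "ce_set (encode ` ?BX)"
    using assms(2) by (auto simp: computable_compact_def semicomputable_def ball_encode_eq)
  have Y: "compactin Q.mtopology Y" and ceY: "ce_set (encode ` ?CY)"
    using assms(6) by (auto simp: semicomputable_def ball_list_encode_eq)
  obtain f g \<mu> \<nu> where fg: "homeomorphic_maps (subspace_Q X) (subspace_Q Y) f g"
      and \<mu>: "computable \<mu>" "uniform_modulus \<mu> X f" and \<nu>: "computable \<nu>" "uniform_modulus \<nu> Y g"
    using assms(5) unfolding simple_copy_def has_computable_modulus_def computable_nat_iff by blast
  have f: "f ` X \<subseteq> Y" and g: "g ` Y \<subseteq> X" and gf: "\<And>x. x \<in> X \<Longrightarrow> g (f x) = x"
    using fg assms(1,4) by (auto simp: homeomorphic_maps_def continuous_map_def)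
  have "ce_set (encode ` ?BY)"
  \<comment> \<open>The enumeration below needs a ball known to meet \<open>Y\<close> as default
    output; the empty set is enumerable by definition.\<close>
  proof (cases "?BY = {}")
    case True
    then have "encode ` ?BY = {}"
      by (simp only: image_empty)
    then show ?thesis
      by (simp add: ce_set_def)
  next
    case False
    then obtain B0 where B0: "B0 \<in> ?BY"
      by blast
    then have "X \<noteq> {}"
      using g by blast
    then obtain x0 where "x0 \<in> X"
      by blast
    then obtain b0 where "b0 \<in> rational_balls" "x0 \<in> ball_set b0"
      using small_rational_ball assms(1) by blast
    then have "?BX \<noteq> {}"
      using \<open>x0 \<in> X\<close> by blast
    obtain eX :: "nat \<Rightarrow> rational_ball" where eX: "computable eX" "range eX = ?BX"
      by (rule ce_set_enumeration[OF ceX \<open>?BX \<noteq> {}\<close>], rule that)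
    obtain C0 where "set C0 \<subseteq> rational_balls" "Y \<subseteq> (\<Union>c\<in>set C0. ball_set c)"
      by (rule small_rational_cover[OF Y, of 0]) blast
    then have "C0 \<in> ?CY"
      by auto
    then have "?CY \<noteq> {}"
      by blast
    obtain eY :: "nat \<Rightarrow> rational_ball list" where eY: "computable eY" "range eY = ?CY"
      by (rule ce_set_enumeration[OF ceY \<open>?CY \<noteq> {}\<close>], rule that)
    \<comment> \<open>Every rational ball is the head of some list covering \<open>Y\<close>, so \<open>eY\<close> also enumerates the
      candidates \<open>B\<close>.\<close>
    define cand where "cand k = (case eY k of [] \<Rightarrow> B0 | B # _ \<Rightarrow> B)" for k
    \<comment> \<open>The components of \<open>t\<close> are the indices of balls meeting
      \<open>X\<close>, the index of the candidate, the index of the cover, and the bound on the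
      precisions. Being built from naturals, such tuples have a surjective coding.\<close>
    define cert where "cert t \<longleftrightarrow> refuted \<mu> \<nu> (cand (fst (snd t)))
      (map eX (fst t)) (eY (fst (snd (snd t)))) (snd (snd (snd t)))" for t :: "nat list \<times> nat \<times> nat \<times> nat"
    \<comment> \<open>A failed test outputs \<open>B0\<close>, which meets \<open>Y\<close>, so the
      function is total and never lists a wrong ball.\<close>
    define enum where "enum t = (if cert t then cand (fst (snd t)) else B0)" for t
    have cand: "computable cand" "\<And>k. cand k \<in> rational_balls"
    proof -
      show "computable cand"
        unfolding cand_def by (intro computable_intros eY(1))
      fix k
      have "eY k \<in> lists rational_balls"
        using eY(2) by blast
      then show "cand k \<in> rational_balls"
        using B0 by (auto simp: cand_def split: list.split)
    qed
    have "computable enum"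
      unfolding enum_def cert_def
      by (intro computable_intros computable_refuted \<mu>(1) \<nu>(1) computable_comp[OF cand(1)]
          computable_comp[OF eX(1)] computable_comp[OF eY(1)])
    then have "ce_set (encode ` range enum)"
      by (rule ce_set_range) (intro surj_encode_prod surj_encode_nat surj_encode_nat_list)
    moreover have "range enum = ?BY"
    proof (intro equalityI subsetI)
      fix B assume "B \<in> range enum"
      then obtain t where t: "B = enum t"
        by blast
      show "B \<in> ?BY"
      proof (cases "cert t")
        case True
        have "set (eY (fst (snd (snd t)))) \<subseteq> rational_balls" "Y \<subseteq> (\<Union>c\<in>set (eY (fst (snd (snd t)))). ball_set c)"
          using eY(2) by blast+
        then have "ball_set (cand (fst (snd t))) \<inter> Y \<noteq> {}"
          using eX(2) True unfolding cert_def
          by (intro refuted_imp_meets[OF assms(1) f gf \<mu>(2) \<nu>(2) cand(2)]) auto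
        then show ?thesis
          using True cand(2) by (simp add: t enum_def)
      qed (use B0 in \<open>simp add: t enum_def\<close>)
    next
      fix B assume "B \<in> ?BY"
      then have B: "B \<in> rational_balls" "ball_set B \<inter> Y \<noteq> {}"
        by auto
      obtain bs cs N where bs: "set bs \<subseteq> ?BX" and cs: "set cs \<subseteq> rational_balls" "Y \<subseteq> (\<Union>c\<in>set cs. ball_set c)"
          and ref: "refuted \<mu> \<nu> B bs cs N"
        using refuted_if_meets[OF X \<open>X \<noteq> {}\<close> Y fg assms(3) B] by blast
      obtain ixs where ixs: "bs = map eX ixs"
        using bs eX(2) by (metis ex_map_conv subsetD rangeE)
      have "cs \<in> range eY" "B # cs \<in> range eY"
        using cs B(1) unfolding eY(2) by auto
      then obtain j k where "cs = eY j" "B # cs = eY k"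
        by blast
      then have "cand k = B" "cert (ixs, k, j, N)"
        using ref by (simp_all add: cand_def cert_def ixs flip: \<open>B # cs = eY k\<close>)
      then show "B \<in> range enum"
        by (intro range_eqI[of _ _ "(ixs, k, j, N)"]) (simp add: enum_def)
    qed
    ultimately show ?thesis
      by simp
  qed
  with assms(6) show ?thesis
    by (simp add: computable_compact_def ball_encode_eq)
qed

end
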